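(* For any $n,k$ and sufficiently small constant $\epsilon>0$, the class $\mathcal{L}_n^{\cap k}$ of intersections of $k$ halfspaces over $\mathbb{R}^n$ satisfies $$m^{\mathrm{test}}_\epsilon(\mathcal{L}_n^{\cap k})=\Omega\left(\frac{nk}{\log(nk)}\right)\qquad\text{and}\qquad q^{\mathrm{test}}_{0,\epsilon}(\mathcal{L}_n^{\cap k})=\Omega\left(\frac{nk}{\log(nk)}\right).$$
   Context: Here $n,k$ are positive integers. A halfspace is a function of the form $h(x)=\mathrm{sign}(w_0+\sum_{i=1}^n w_ix_i)$ on $\mathbb{R}^n$ with $w_0,\dots,w_n\in\mathbb{R}$, taking values in $\{\pm1\}$, with $1$ read as "true" and $-1$ as "false". $\mathcal{L}_n^{\cap k}$ is the set of functions $f(x)=h_1(x)\wedge h_2(x)\wedge\dots\wedge h_k(x)$ where each $h_i$ is a halfspace. For a class $\mathcal{H}$ of two-valued functions on $\mathcal{X}$ and a probability distribution $\mathcal{D}$ on $\mathcal{X}$, $\mathrm{dist}_{\mathcal{D}}(f,g)=\Pr_{x\sim\mathcal{D}}[f(x)\ne g(x)]$ and $\mathrm{dist}_{\mathcal{D}}(f,\mathcal{H})=\inf_{h\in\mathcal{H}}\mathrm{dist}_{\mathcal{D}}(f,h)$. All testers are randomized algorithms that must work for every unknown distribution $\mathcal{D}$ on $\mathcal{X}$ and every unknown two-valued function $f$ on $\mathcal{X}$. (i) $m^{\mathrm{test}}_\epsilon(\mathcal{H})$ is the minimum $m$ such that some algorithm receiving $m$ labelled examples $(x,f(x))$, with each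 $x\sim\mathcal{D}$ drawn independently, accepts with probability at least $2/3$ if $f\in\mathcal{H}$ and rejects with probability at least $2/3$ if $\mathrm{dist}_{\mathcal{D}}(f,\mathcal{H})\ge\epsilon$. (ii) $q^{\mathrm{test}}_{0,\epsilon}(\mathcal{H})$ is the minimum $q$ such that some algorithm, using in total at most $q$ values of $f$ obtained either by (adaptive) queries at arbitrary points of $\mathcal{X}$ or by independent labelled samples $(x,f(x))$ with $x\sim\mathcal{D}$, accepts with probability at least $2/3$ if $\mathrm{dist}_{\mathcal{D}}(f,\mathcal{H})=0$ and rejects with probability at least $2/3$ if $\mathrm{dist}_{\mathcal{D}}(f,\mathcal{H})\ge\epsilon$.
   Formalization: For n = 1 the Omega-constant may depend on k: intersections of k halfspaces on the line are just intervals (testable with boundedly many samples for all k), so no uniform constant exists; at n = k = 1, where nk/log(nk) is undefined, nothing is claimed. *)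

theory Defs
  imports "HOL-Probability.Probability"
begin

text \<open>
  Throughout, \<open>M\<close> is the measurable space playing the role of \<open>\<X>\<close>. Two-valued functions are
  \<open>bool\<close>-valued (\<open>True\<close> for \<open>1\<close>, \<open>False\<close> for \<open>-1\<close>); only their values on \<open>space M\<close> matter.
\<close>

definition distribution_on :: "'a measure \<Rightarrow> 'a measure \<Rightarrow> bool" where
  "distribution_on M D \<longleftrightarrow> prob_space D \<and> sets D = sets M"

definition fun_dist :: "'a measure \<Rightarrow> ('a \<Rightarrow> bool) \<Rightarrow> ('a \<Rightarrow> bool) \<Rightarrow> real" where
  "fun_dist D f g = measure D {x \<in> space D. f x \<noteq> g x}"

definition class_dist :: "'a measure \<Rightarrow> ('a \<Rightarrow> bool) \<Rightarrow> ('a \<Rightarrow> bool) set \<Rightarrow> real" where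
  "class_dist D f H = (INF h\<in>H. fun_dist D f h)"

definition in_class :: "'a measure \<Rightarrow> ('a \<Rightarrow> bool) \<Rightarrow> ('a \<Rightarrow> bool) set \<Rightarrow> bool" where
  "in_class M f H \<longleftrightarrow> (\<exists>h\<in>H. \<forall>x\<in>space M. f x = h x)"


text \<open>
  A randomized algorithm is a deterministic one that in addition reads a random seed, drawn
  independently of the samples from an arbitrary probability space \<open>R\<close> over the reals. No
  measurability is imposed on the algorithms: \<open>measure\<close> is \<open>0\<close> on non-measurable sets, so an outcome
  required below to have probability at least \<open>2/3\<close> is necessarily an event.
\<close>

definition labelled_sample :: "('a \<Rightarrow> bool) \<Rightarrow> nat \<Rightarrow> (nat \<Rightarrow> 'a) \<Rightarrow> ('a \<times> bool) list" where
  "labelled_sample f m xs = map (\<lambda>i. (xs i, f (xs i))) [0..<m]"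

definition sample_outcome_prob ::
  "real measure \<Rightarrow> 'a measure \<Rightarrow> ('a \<Rightarrow> bool) \<Rightarrow> nat \<Rightarrow>
   (real \<Rightarrow> ('a \<times> bool) list \<Rightarrow> bool) \<Rightarrow> bool \<Rightarrow> real" where
  "sample_outcome_prob R D f m A b =
     measure (R \<Otimes>\<^sub>M PiM {..<m} (\<lambda>_. D))
       {(r, xs) \<in> space (R \<Otimes>\<^sub>M PiM {..<m} (\<lambda>_. D)). A r (labelled_sample f m xs) = b}"

definition sample_tester ::
  "'a measure \<Rightarrow> real \<Rightarrow> ('a \<Rightarrow> bool) set \<Rightarrow> nat \<Rightarrow>
   real measure \<Rightarrow> (real \<Rightarrow> ('a \<times> bool) list \<Rightarrow> bool) \<Rightarrow> bool" where
  "sample_tester M \<epsilon> H m R A \<longleftrightarrow>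
     prob_space R \<and>
     (\<forall>D f. distribution_on M D \<and> f \<in> measurable M (count_space UNIV) \<longrightarrow>
        (in_class M f H \<longrightarrow> sample_outcome_prob R D f m A True \<ge> 2/3) \<and>
        (class_dist D f H \<ge> \<epsilon> \<longrightarrow> sample_outcome_prob R D f m A False \<ge> 2/3))"

text \<open>The minimum is taken in \<open>enat\<close>, so that it is \<open>\<infinity>\<close> if there is no tester at all.\<close>

definition m_test :: "'a measure \<Rightarrow> real \<Rightarrow> ('a \<Rightarrow> bool) set \<Rightarrow> enat" where
  "m_test M \<epsilon> H = Inf {enat m | m. \<exists>R A. sample_tester M \<epsilon> H m R A}"


text \<open>
  A deterministic adaptive algorithm: it answers, or queries \<open>f\<close> at a point and continues
  depending on the value, or requests a fresh labelled sample and continues depending on it.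
\<close>

datatype 'a strategy =
    Answer bool
  | Query 'a "bool \<Rightarrow> 'a strategy"
  | Sample "'a \<Rightarrow> bool \<Rightarrow> 'a strategy"

primrec run :: "('a \<Rightarrow> bool) \<Rightarrow> 'a strategy \<Rightarrow> (nat \<Rightarrow> 'a) \<Rightarrow> bool" where
  "run f (Answer b) = (\<lambda>xs. b)"
| "run f (Query x c) = (\<lambda>xs. run f (c (f x)) xs)"
| "run f (Sample c) = (\<lambda>xs. run f (c (xs 0) (f (xs 0))) (\<lambda>i. xs (Suc i)))"

text \<open>All queries are made in \<open>X\<close>, and at most \<open>q\<close> values of \<open>f\<close> are used on every path.\<close>

primrec uses_at_most :: "'a set \<Rightarrow> 'a strategy \<Rightarrow> nat \<Rightarrow> bool" where
  "uses_at_most X (Answer b) = (\<lambda>q. True)"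
| "uses_at_most X (Query x c) = (\<lambda>q. x \<in> X \<and> 0 < q \<and> (\<forall>b. uses_at_most X (c b) (q - 1)))"
| "uses_at_most X (Sample c) = (\<lambda>q. 0 < q \<and> (\<forall>x\<in>X. \<forall>b. uses_at_most X (c x b) (q - 1)))"

text \<open>At most \<open>q\<close> samples are ever requested, so it suffices to draw \<open>q\<close> of them in advance.\<close>

definition query_outcome_prob ::
  "real measure \<Rightarrow> 'a measure \<Rightarrow> ('a \<Rightarrow> bool) \<Rightarrow> nat \<Rightarrow> (real \<Rightarrow> 'a strategy) \<Rightarrow> bool \<Rightarrow> real" where
  "query_outcome_prob R D f q A b =
     measure (R \<Otimes>\<^sub>M PiM {..<q} (\<lambda>_. D))
       {(r, xs) \<in> space (R \<Otimes>\<^sub>M PiM {..<q} (\<lambda>_. D)). run f (A r) xs = b}"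

definition query_tester ::
  "'a measure \<Rightarrow> real \<Rightarrow> ('a \<Rightarrow> bool) set \<Rightarrow> nat \<Rightarrow>
   real measure \<Rightarrow> (real \<Rightarrow> 'a strategy) \<Rightarrow> bool" where
  "query_tester M \<epsilon> H q R A \<longleftrightarrow>
     prob_space R \<and> (\<forall>r\<in>space R. uses_at_most (space M) (A r) q) \<and>
     (\<forall>D f. distribution_on M D \<and> f \<in> measurable M (count_space UNIV) \<longrightarrow>
        (class_dist D f H = 0 \<longrightarrow> query_outcome_prob R D f q A True \<ge> 2/3) \<and>
        (class_dist D f H \<ge> \<epsilon> \<longrightarrow> query_outcome_prob R D f q A False \<ge> 2/3))"

definition q_test0 :: "'a measure \<Rightarrow> real \<Rightarrow> ('a \<Rightarrow> bool) set \<Rightarrow> enat" where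
  "q_test0 M \<epsilon> H = Inf {enat q | q. \<exists>R A. query_tester M \<epsilon> H q R A}"


text \<open>
  The dimension varies inside the theorem, so \<open>\<real>\<close>\<open>\<^sup>n\<close> is the product Borel space over the index set
  \<open>{..<n}\<close>; its points are the extensional functions \<open>{..<n} \<rightarrow>\<^sub>E UNIV\<close>.
\<close>

definition Rn :: "nat \<Rightarrow> (nat \<Rightarrow> real) measure" where
  "Rn n = PiM {..<n} (\<lambda>_. borel)"

text \<open>The convention \<open>sign 0 = 1\<close> is used.\<close>

definition halfspaces :: "nat \<Rightarrow> ((nat \<Rightarrow> real) \<Rightarrow> bool) set" where
  "halfspaces n = {h. \<exists>w0 w. h = (\<lambda>x. w0 + (\<Sum>i<n. w i * x i) \<ge> 0)}"

text \<open>
  For \<open>n = 1\<close> these are intervals whatever \<open>k\<close> is, so that for fixed \<open>\<epsilon>\<close> boundedly many samples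
  suffice for all \<open>k\<close>; the constant in a lower bound growing with \<open>k\<close> then has to depend on \<open>k\<close>.
\<close>

definition halfspace_intersections :: "nat \<Rightarrow> nat \<Rightarrow> ((nat \<Rightarrow> real) \<Rightarrow> bool) set" where
  "halfspace_intersections n k =
     {f. \<exists>h. (\<forall>j<k. h j \<in> halfspaces n) \<and> f = (\<lambda>x. \<forall>j<k. h j x)}"

end

theory Submission
  imports Defs "HOL-Computational_Algebra.Polynomial" "HOL-Real_Asymp.Real_Asymp"
begin

text \<open>
  Both testers are reduced to telling a sparse distribution from a dense one. Put sites on the moment
  curve \<open>t \<mapsto> (t, t\<^sup>2, \<dots>, t\<^sup>n)\<close> at the integers \<open>0 \<le> t < N\<close>, where \<open>N = 8nk\<close>, and label them by parity.
  Any \<open>\<lfloor>n/2\<rfloor>\<close> of them are cut off by one halfspace, so a distribution charging at most \<open>k\<lfloor>n/2\<rfloor>\<close> sites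
  makes the labelling agree almost surely with an intersection of \<open>k\<close> halfspaces. Such an intersection
  changes sign at most \<open>nk\<close> times along the curve, so a distribution that is nearly uniform on the sites
  makes the labelling far from the class. The labelling is the same in both cases, so queries to it
  carry no information.
  
  Let the mass at site \<open>i\<close> be \<open>U\<^sub>i / s\<close> with \<open>U\<^sub>i\<close> independent with law \<open>\<alpha>\<close> (mostly \<open>0\<close>) or \<open>\<beta>\<close> (mostly \<open>1\<close>),
  and give the remaining mass to one extra point. In terms of a single \<open>U\<^sub>i\<close> the acceptance probability
  after \<open>q\<close> samples is a polynomial whose \<open>r\<close>-th coefficient is at most \<open>(q choose r) (2/s)\<^sup>r\<close>. If \<open>\<alpha>\<close> and \<open>\<beta>\<close>
  live on \<open>[0, O(L\<^sup>2)]\<close> and have the same first \<open>L\<close> moments, where \<open>L\<close> is of order \<open>log N\<close>, then replacing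
  \<open>\<alpha>\<close> by \<open>\<beta>\<close> site by site changes the acceptance probability by little unless \<open>q\<close> is of order \<open>N / L\<close>.
\<close>

section \<open>Expectations over independent coordinates\<close>

text \<open>For weights of total mass 1 this is the expectation of \<open>F\<close> over
  \<open>n\<close> independent draws. Signs of the weights are left free, so that it also covers the
  shifted weights of \<open>wsum_shift_polynomial\<close> for every real \<open>p\<close>. It serves
  both for random site masses (\<open>A = T\<close>) and for samples
  (\<open>A = {..N}\<close>).\<close>

definition wsum :: "'a set \<Rightarrow> ('a \<Rightarrow> real) \<Rightarrow> nat \<Rightarrow> ((nat \<Rightarrow> 'a) \<Rightarrow> real) \<Rightarrow> real" where
  "wsum A w n F = (\<Sum>x\<in>PiE {..<n} (\<lambda>_. A). (\<Prod>i<n. w (x i)) * F x)"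

lemma wsum_0: "wsum A w 0 F = F (\<lambda>_. undefined)"
  by (simp add: wsum_def)

lemma wsum_Suc:
  assumes "finite A"
  shows "wsum A w (Suc n) F = (\<Sum>a\<in>A. w a * wsum A w n (\<lambda>x. F (x(n := a))))"
proof -
  let ?P = "PiE {..<n} (\<lambda>_. A)"
  have inj: "inj_on (\<lambda>(a, x). x(n := a)) (A \<times> ?P)"
    by (rule inj_combinator) simp
  have "wsum A w (Suc n) F =
      (\<Sum>x\<in>(\<lambda>(a, x). x(n := a)) ` (A \<times> ?P). (\<Prod>i<Suc n. w (x i)) * F x)"
    by (simp add: wsum_def lessThan_Suc PiE_insert_eq)
  also have "\<dots> = (\<Sum>(a, x)\<in>A \<times> ?P. (\<Prod>i<Suc n. w ((x(n := a)) i)) * F (x(n := a)))"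
    by (subst sum.reindex[OF inj]) (simp add: o_def case_prod_beta)
  also have "\<dots> = (\<Sum>(a, x)\<in>A \<times> ?P. w a * ((\<Prod>i<n. w (x i)) * F (x(n := a))))"
    by (intro sum.cong refl) (auto simp: mult_ac)
  also have "\<dots> = (\<Sum>a\<in>A. w a * wsum A w n (\<lambda>x. F (x(n := a))))"
    by (simp add: wsum_def sum.cartesian_product sum_distrib_left)
  finally show ?thesis .
qed

text \<open>Tuples of weight zero do not count, so labellings that agree on all charged points give
  the same expectation.\<close>

lemma wsum_cong:
  assumes "\<And>x. x \<in> PiE {..<n} (\<lambda>_. A) \<Longrightarrow> (\<And>i. i < n \<Longrightarrow> w (x i) \<noteq> 0) \<Longrightarrow> F x = G x"
  shows "wsum A w n F = wsum A w n G"
  unfolding wsum_def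
proof (intro sum.cong refl)
  fix x assume x: "x \<in> PiE {..<n} (\<lambda>_. A)"
  show "(\<Prod>i<n. w (x i)) * F x = (\<Prod>i<n. w (x i)) * G x"
  proof (cases "\<exists>i<n. w (x i) = 0")
    case True
    then show ?thesis by auto
  next
    case False
    then show ?thesis using assms[OF x] by auto
  qed
qed

lemma wsum_mono:
  assumes "\<And>a. a \<in> A \<Longrightarrow> 0 \<le> w a"
    and "\<And>x. x \<in> PiE {..<n} (\<lambda>_. A) \<Longrightarrow> F x \<le> G x"
  shows "wsum A w n F \<le> wsum A w n G"
  unfolding wsum_def
  by (intro sum_mono mult_left_mono assms prod_nonneg) (auto simp: PiE_def Pi_def assms(1))

lemma wsum_nonneg:
  assumes "\<And>a. a \<in> A \<Longrightarrow> 0 \<le> w a" and "\<And>x. 0 \<le> F x"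
  shows "0 \<le> wsum A w n F"
  unfolding wsum_def
  by (intro sum_nonneg mult_nonneg_nonneg prod_nonneg assms) (auto simp: PiE_def Pi_def)

lemma wsum_add: "wsum A w n (\<lambda>x. F x + G x) = wsum A w n F + wsum A w n G"
  by (simp add: wsum_def distrib_left sum.distrib)

lemma wsum_diff: "wsum A w n (\<lambda>x. F x - G x) = wsum A w n F - wsum A w n G"
  by (simp add: wsum_def right_diff_distrib sum_subtractf)

lemma wsum_cmult: "wsum A w n (\<lambda>x. c * F x) = c * wsum A w n F"
  by (simp add: wsum_def sum_distrib_left mult_ac)

lemma wsum_sum: "wsum A w n (\<lambda>x. \<Sum>i\<in>I. F i x) = (\<Sum>i\<in>I. wsum A w n (F i))"
  by (simp add: wsum_def sum_distrib_left) (rule sum.swap)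

lemma abs_wsum_le:
  assumes "\<And>a. a \<in> A \<Longrightarrow> 0 \<le> w a"
    and "\<And>x. x \<in> PiE {..<n} (\<lambda>_. A) \<Longrightarrow> \<bar>F x\<bar> \<le> G x"
  shows "\<bar>wsum A w n F\<bar> \<le> wsum A w n G"
proof -
  have "wsum A w n F \<le> wsum A w n G"
    by (rule wsum_mono) (use assms in \<open>auto dest: abs_le_D1\<close>)
  moreover have "wsum A w n (\<lambda>x. (-1) * F x) \<le> wsum A w n G"
    by (rule wsum_mono) (use assms in \<open>auto dest: abs_le_D2\<close>)
  ultimately show ?thesis unfolding wsum_cmult by linarith
qed

lemma wsum_prod:
  assumes "finite A"
  shows "wsum A w n (\<lambda>x. \<Prod>i<n. g (x i)) = (\<Sum>a\<in>A. w a * g a) ^ n"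
proof (induction n)
  case (Suc n)
  have eq: "(\<Prod>i<Suc n. g ((x(n := a)) i)) = g a * (\<Prod>i<n. g (x i))" for x a
    by (simp add: mult.commute)
  show ?case
    unfolding wsum_Suc[OF assms] eq wsum_cmult Suc
    by (simp add: sum_distrib_right mult_ac)
qed (simp add: wsum_0)

lemma wsum_const:
  assumes "finite A" and "sum w A = 1"
  shows "wsum A w n (\<lambda>_. c) = c"
  using wsum_prod[OF assms(1), of w n "\<lambda>_. 1"] wsum_cmult[of A w n c "\<lambda>_. 1"] assms(2) by simp

lemma wsum_sum_coordinates:
  assumes "finite A" and "sum w A = 1"
  shows "wsum A w n (\<lambda>x. \<Sum>i<n. g (x i)) = real n * (\<Sum>a\<in>A. w a * g a)"
proof (induction n)
  case (Suc n)
  have eq: "(\<Sum>i<Suc n. g ((x(n := a)) i)) = g a + (\<Sum>i<n. g (x i))" for x a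
    by (simp add: add.commute)
  show ?case
    unfolding wsum_Suc[OF assms(1)] eq wsum_add wsum_const[OF assms] Suc
    by (simp add: distrib_left sum.distrib assms(2) algebra_simps flip: sum_distrib_left sum_distrib_right)
qed (simp add: wsum_0)

lemma wsum_markov:
  assumes "finite A" "sum w A = 1" and w: "\<And>a. a \<in> A \<Longrightarrow> 0 \<le> w a"
    and g: "\<And>a. a \<in> A \<Longrightarrow> 0 \<le> g a" and "B > 0"
  shows "wsum A w n (\<lambda>x. of_bool ((\<Sum>i<n. g (x i)) > B)) \<le> real n * (\<Sum>a\<in>A. w a * g a) / B"
proof -
  have "wsum A w n (\<lambda>x. of_bool ((\<Sum>i<n. g (x i)) > B)) \<le> wsum A w n (\<lambda>x. (1 / B) * (\<Sum>i<n. g (x i)))"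
  proof (rule wsum_mono)
    fix x assume x: "x \<in> PiE {..<n} (\<lambda>_. A)"
    have "0 \<le> (\<Sum>i<n. g (x i))" by (rule sum_nonneg) (use g x in auto)
    then show "of_bool ((\<Sum>i<n. g (x i)) > B) \<le> (1 / B) * (\<Sum>i<n. g (x i))"
      using \<open>B > 0\<close> by (auto simp: field_simps)
  qed (use w in auto)
  then show ?thesis
    by (simp only: wsum_cmult wsum_sum_coordinates[OF assms(1,2)]) simp
qed

text \<open>
  The laws of the coordinates are exchanged one at a time. The bound on a single exchange may grow
  multiplicatively in the other coordinates, which will absorb the event that they are too large.
\<close>

lemma wsum_hybrid:
  fixes \<alpha> \<beta> \<phi> :: "'a \<Rightarrow> real"
  assumes fin: "finite A"
    and \<alpha>: "\<And>a. a \<in> A \<Longrightarrow> 0 \<le> \<alpha> a" "sum \<alpha> A = 1"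
    and \<beta>: "\<And>a. a \<in> A \<Longrightarrow> 0 \<le> \<beta> a" "sum \<beta> A = 1"
    and \<phi>: "\<And>a. a \<in> A \<Longrightarrow> 0 \<le> \<phi> a" "(\<Sum>a\<in>A. \<alpha> a * \<phi> a) \<le> \<rho>" "(\<Sum>a\<in>A. \<beta> a * \<phi> a) \<le> \<rho>"
    and "\<kappa> \<ge> 0"
    and site: "\<And>i U. i < n \<Longrightarrow> U \<in> PiE {..<n} (\<lambda>_. A) \<Longrightarrow>
      \<bar>\<Sum>a\<in>A. (\<alpha> a - \<beta> a) * F (U(i := a))\<bar> \<le> \<delta> + \<kappa> * (\<Prod>j\<in>{..<n} - {i}. \<phi> (U j))"
  shows "\<bar>wsum A \<alpha> n F - wsum A \<beta> n F\<bar> \<le> real n * (\<delta> + \<kappa> * \<rho> ^ (n - 1))"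
  using \<open>\<kappa> \<ge> 0\<close> site
proof (induction n arbitrary: F \<kappa>)
  case 0
  then show ?case by (simp add: wsum_0)
next
  case (Suc n)
  have \<rho>0: "0 \<le> \<rho>"
    by (rule order_trans[OF sum_nonneg \<phi>(2)]) (use \<alpha> \<phi> in auto)
  define F' where "F' a = (\<lambda>U. F (U(n := a)))" for a
  \<comment> \<open>The factor \<open>\<phi> a\<close> of the last coordinate is absorbed into
    \<open>\<kappa>\<close>, which is why the induction generalises over
    \<open>\<kappa>\<close>.\<close>
  have IH: "\<bar>wsum A \<alpha> n (F' a) - wsum A \<beta> n (F' a)\<bar> \<le> real n * (\<delta> + (\<kappa> * \<phi> a) * \<rho> ^ (n - 1))"
    if a: "a \<in> A" for a
  proof (rule Suc.IH)
    show "0 \<le> \<kappa> * \<phi> a" using Suc.prems(1) \<phi>(1)[OF a] by simp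
    fix i U assume i: "i < n" and U: "U \<in> PiE {..<n} (\<lambda>_. A)"
    have U': "U(n := a) \<in> PiE {..<Suc n} (\<lambda>_. A)"
      using U a by (auto simp: lessThan_Suc intro!: PiE_fun_upd)
    have set_eq: "{..<Suc n} - {i} = insert n ({..<n} - {i})" using i by auto
    have upd: "(U(n := a))(i := b) = (U(i := b))(n := a)" for b
      using i by (auto simp: fun_eq_iff)
    have "(\<Prod>j\<in>{..<n} - {i}. \<phi> ((U(n := a)) j)) = (\<Prod>j\<in>{..<n} - {i}. \<phi> (U j))"
      by (intro prod.cong) auto
    then show "\<bar>\<Sum>b\<in>A. (\<alpha> b - \<beta> b) * F' a (U(i := b))\<bar>
        \<le> \<delta> + \<kappa> * \<phi> a * (\<Prod>j\<in>{..<n} - {i}. \<phi> (U j))"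
      using Suc.prems(2)[OF less_SucI[OF i] U'] unfolding F'_def set_eq upd
      by (simp only: prod.insert[OF finite_Diff[OF finite_lessThan]] Diff_iff lessThan_iff less_irrefl
        simp_thms fun_upd_same mult.assoc)
  qed
  \<comment> \<open>Telescoping: the first \<open>n\<close> coordinates are exchanged while the last
    one has law \<alpha>, then the last one is exchanged while the others have law \<beta>.\<close>
  have "wsum A \<alpha> (Suc n) F - wsum A \<beta> (Suc n) F
      = (\<Sum>a\<in>A. \<alpha> a * (wsum A \<alpha> n (F' a) - wsum A \<beta> n (F' a)))
        + wsum A \<beta> n (\<lambda>U. \<Sum>a\<in>A. (\<alpha> a - \<beta> a) * F' a U)"
    unfolding wsum_Suc[OF fin] wsum_sum wsum_cmult F'_def sum_subtractf[symmetric] sum.distrib[symmetric]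
    by (intro sum.cong refl) (simp add: algebra_simps)
  moreover have "\<bar>\<Sum>a\<in>A. \<alpha> a * (wsum A \<alpha> n (F' a) - wsum A \<beta> n (F' a))\<bar>
      \<le> real n * (\<delta> + \<kappa> * \<rho> ^ n)"
  proof -
    have "\<bar>\<Sum>a\<in>A. \<alpha> a * (wsum A \<alpha> n (F' a) - wsum A \<beta> n (F' a))\<bar>
        \<le> (\<Sum>a\<in>A. \<alpha> a * (real n * (\<delta> + (\<kappa> * \<phi> a) * \<rho> ^ (n - 1))))"
      by (rule order_trans[OF sum_abs]) (auto intro!: sum_mono mult_left_mono IH[simplified] simp: abs_mult \<alpha>)
    also have "\<dots> = real n * \<delta> * sum \<alpha> A + real n * \<kappa> * \<rho> ^ (n - 1) * (\<Sum>a\<in>A. \<alpha> a * \<phi> a)"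
      by (simp add: sum_distrib_left sum.distrib[symmetric] algebra_simps)
    also have "\<dots> \<le> real n * \<delta> + real n * \<kappa> * \<rho> ^ (n - 1) * \<rho>"
      using \<alpha>(2) \<phi>(2) Suc.prems(1) \<rho>0 by (auto intro!: mult_left_mono)
    also have "\<dots> = real n * (\<delta> + \<kappa> * \<rho> ^ n)"
      by (cases n) (auto simp: algebra_simps)
    finally show ?thesis .
  qed
  moreover have "\<bar>wsum A \<beta> n (\<lambda>U. \<Sum>a\<in>A. (\<alpha> a - \<beta> a) * F' a U)\<bar> \<le> \<delta> + \<kappa> * \<rho> ^ n"
  proof -
    have "A \<noteq> {}" using \<alpha>(2) by auto
    \<comment> \<open>The value at \<open>n\<close> is overwritten in every term; \<open>a0\<close>
      merely completes \<open>U\<close> to a point with \<open>Suc n\<close> coordinates, to which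
      the hypothesis applies.\<close>
    then obtain a0 where a0: "a0 \<in> A" by auto
    have "\<bar>wsum A \<beta> n (\<lambda>U. \<Sum>a\<in>A. (\<alpha> a - \<beta> a) * F' a U)\<bar>
      \<le> wsum A \<beta> n (\<lambda>U. \<delta> + \<kappa> * (\<Prod>j<n. \<phi> (U j)))"
    proof (rule abs_wsum_le)
      fix U assume U: "U \<in> PiE {..<n} (\<lambda>_. A)"
      have U': "U(n := a0) \<in> PiE {..<Suc n} (\<lambda>_. A)"
        using U a0 by (auto simp: lessThan_Suc intro!: PiE_fun_upd)
      have set_eq: "{..<Suc n} - {n} = {..<n}" by auto
      have "(\<Prod>j<n. \<phi> ((U(n := a0)) j)) = (\<Prod>j<n. \<phi> (U j))"
        by (intro prod.cong) auto
      then show "\<bar>\<Sum>a\<in>A. (\<alpha> a - \<beta> a) * F' a U\<bar> \<le> \<delta> + \<kappa> * (\<Prod>j<n. \<phi> (U j))"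
        using Suc.prems(2)[OF lessI U'] by (simp only: F'_def set_eq fun_upd_upd)
    qed (use \<beta> in auto)
    also have "\<dots> = \<delta> + \<kappa> * (\<Sum>a\<in>A. \<beta> a * \<phi> a) ^ n"
      unfolding wsum_add wsum_cmult wsum_prod[OF fin] wsum_const[OF fin \<beta>(2)] ..
    also have "\<dots> \<le> \<delta> + \<kappa> * \<rho> ^ n"
      using Suc.prems(1) \<phi> \<beta> by (intro add_left_mono mult_left_mono power_mono sum_nonneg) auto
    finally show ?thesis .
  qed
  ultimately have "\<bar>wsum A \<alpha> (Suc n) F - wsum A \<beta> (Suc n) F\<bar> \<le> real n * (\<delta> + \<kappa> * \<rho> ^ n) + (\<delta> + \<kappa> * \<rho> ^ n)"
    by linarith
  then show ?case by (simp add: algebra_simps)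
qed

text \<open>
  Moving mass \<open>p\<close> from \<open>j\<close> to \<open>i\<close> adds \<open>p\<close> times a signed measure of total variation \<open>2\<close> to the law of each of
  the \<open>q\<close> samples; expanding the product gives the binomial coefficient and the factor \<open>2\<^sup>r\<close>.
\<close>

lemma wsum_shift_polynomial:
  assumes fin: "finite A" and w: "\<And>a. a \<in> A \<Longrightarrow> 0 \<le> w a" "sum w A \<le> 1"
    and "i \<in> A" "j \<in> A" and F: "\<And>x. x \<in> PiE {..<q} (\<lambda>_. A) \<Longrightarrow> \<bar>F x\<bar> \<le> 1"
  shows "\<exists>c. (\<forall>r. \<bar>c r\<bar> \<le> real (q choose r) * 2 ^ r) \<and>
    (\<forall>p. wsum A (\<lambda>a. w a + p * (of_bool (a = i) - of_bool (a = j))) q F = (\<Sum>r\<le>q. c r * p ^ r))"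
  using F
proof (induction q arbitrary: F)
  case 0
  then show ?case
    by (intro exI[of _ "\<lambda>r. if r = 0 then F (\<lambda>_. undefined) else 0"] conjI allI) (simp_all add: wsum_0)
next
  case (Suc q)
  let ?W = "\<lambda>p a. w a + p * (of_bool (a = i) - of_bool (a = j))"
  have "\<exists>c. (\<forall>r. \<bar>c r\<bar> \<le> real (q choose r) * 2 ^ r) \<and>
    (\<forall>p. wsum A (?W p) q (\<lambda>x. F (x(q := a))) = (\<Sum>r\<le>q. c r * p ^ r))" if "a \<in> A" for a
  proof (rule Suc.IH)
    fix x assume "x \<in> PiE {..<q} (\<lambda>_. A)"
    then show "\<bar>F (x(q := a))\<bar> \<le> 1"
      using that unfolding lessThan_Suc by (intro Suc.prems[unfolded lessThan_Suc] PiE_fun_upd)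
  qed
  then have "\<forall>a\<in>A. \<exists>c. (\<forall>r. \<bar>c r\<bar> \<le> real (q choose r) * 2 ^ r) \<and>
    (\<forall>p. wsum A (?W p) q (\<lambda>x. F (x(q := a))) = (\<Sum>r\<le>q. c r * p ^ r))" by blast
  from bchoice[OF this] obtain c where c: "\<And>a r. a \<in> A \<Longrightarrow> \<bar>c a r\<bar> \<le> real (q choose r) * 2 ^ r"
    and ceq: "\<And>a p. a \<in> A \<Longrightarrow> wsum A (?W p) q (\<lambda>x. F (x(q := a))) = (\<Sum>r\<le>q. c a r * p ^ r)"
    by blast
  \<comment> \<open>\<open>e\<close> collects the contribution of the unshifted weights,
    \<open>d\<close> that of the transfer from \<open>j\<close> to \<open>i\<close>, whose factor
    \<open>p\<close> raises the degree by one. The two bounds add up by Pascal's rule.\<close>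
  define e where "e r = (\<Sum>a\<in>A. w a * c a r)" for r
  define d where "d r = (case r of 0 \<Rightarrow> 0 | Suc r' \<Rightarrow> c i r' - c j r')" for r
  have e: "\<bar>e r\<bar> \<le> real (q choose r) * 2 ^ r" for r
  proof -
    have "\<bar>e r\<bar> \<le> (\<Sum>a\<in>A. w a * (real (q choose r) * 2 ^ r))"
      unfolding e_def by (rule order_trans[OF sum_abs]) (auto intro!: sum_mono mult_left_mono c simp: abs_mult w)
    also have "\<dots> = sum w A * (real (q choose r) * 2 ^ r)" by (simp add: sum_distrib_right)
    also have "\<dots> \<le> real (q choose r) * 2 ^ r"
      using w(2) by (intro mult_left_le_one_le sum_nonneg w) auto
    finally show ?thesis .
  qed
  have e_top: "e (Suc q) = 0" using e[of "Suc q"] by (simp add: binomial_eq_0)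
  show ?case
  proof (intro exI[of _ "\<lambda>r. e r + d r"] conjI allI)
    fix r
    show "\<bar>e r + d r\<bar> \<le> real (Suc q choose r) * 2 ^ r"
    proof (cases r)
      case 0
      then show ?thesis using e[of 0] by (simp add: d_def)
    next
      case (Suc r')
      then show ?thesis
        using e[of r] c[OF \<open>i \<in> A\<close>, of r'] c[OF \<open>j \<in> A\<close>, of r'] by (simp add: d_def algebra_simps)
    qed
  next
    fix p
    have *: "(\<Sum>a\<in>A. ?W p a * X a) = (\<Sum>a\<in>A. w a * X a) + p * (X i - X j)" for X :: "'a \<Rightarrow> real"
    proof -
      have "(\<Sum>a\<in>A. ?W p a * X a) = (\<Sum>a\<in>A. w a * X a) + p * ((\<Sum>a\<in>A. of_bool (a = i) * X a) - (\<Sum>a\<in>A. of_bool (a = j) * X a))"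
        by (simp add: algebra_simps sum.distrib sum_subtractf sum_distrib_left)
      moreover have "(\<Sum>a\<in>A. of_bool (a = i') * X a) = X i'" if "i' \<in> A" for i'
        using that fin by (simp add: of_bool_def if_distrib[of "\<lambda>y. y * _"] cong: if_cong)
      ultimately show ?thesis using \<open>i \<in> A\<close> \<open>j \<in> A\<close> by simp
    qed
    have "wsum A (?W p) (Suc q) F = (\<Sum>a\<in>A. ?W p a * (\<Sum>r\<le>q. c a r * p ^ r))"
      unfolding wsum_Suc[OF fin] by (intro sum.cong refl arg_cong2[where f = "(*)"] ceq)
    also have "\<dots> = (\<Sum>a\<in>A. w a * (\<Sum>r\<le>q. c a r * p ^ r)) + p * ((\<Sum>r\<le>q. c i r * p ^ r) - (\<Sum>r\<le>q. c j r * p ^ r))"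
      by (rule *)
    also have "(\<Sum>a\<in>A. w a * (\<Sum>r\<le>q. c a r * p ^ r)) = (\<Sum>r\<le>q. e r * p ^ r)"
      unfolding e_def sum_distrib_left sum_distrib_right by (subst sum.swap) (simp add: mult_ac)
    also have "(\<Sum>r\<le>q. e r * p ^ r) = (\<Sum>r\<le>Suc q. e r * p ^ r)"
      using e_top by simp
    also have "p * ((\<Sum>r\<le>q. c i r * p ^ r) - (\<Sum>r\<le>q. c j r * p ^ r)) = (\<Sum>r\<le>q. d (Suc r) * p ^ Suc r)"
      by (simp add: d_def sum_subtractf[symmetric] sum_distrib_left algebra_simps)
    also have "\<dots> = (\<Sum>r\<le>Suc q. d r * p ^ r)"
      unfolding sum.atMost_Suc_shift by (simp add: d_def)
    finally show "wsum A (?W p) (Suc q) F = (\<Sum>r\<le>Suc q. (e r + d r) * p ^ r)"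
      by (simp add: sum.distrib algebra_simps)
  qed
qed

section \<open>Two laws with equal moments\<close>

text \<open>Lagrange interpolation of \<open>t ^ r\<close> on \<open>T\<close> returns the monomial
  itself, because \<open>r < card T\<close>. The sum is the coefficient of degree
  \<open>card T - 1\<close> of the interpolant, which lies above \<open>r\<close>. Hence the weights
  of a divided difference annihilate all low powers.\<close>

lemma lagrange_leading_coefficient:
  fixes T :: "'a::field set"
  assumes fin: "finite T" and r: "Suc r < card T"
  shows "(\<Sum>t\<in>T. t ^ r / (\<Prod>s\<in>T - {t}. t - s)) = 0"
proof -
  define B where "B t = (\<Prod>s\<in>T - {t}. [:- s, 1:])" for t
  define P where "P = (\<Sum>t\<in>T. smult (t ^ r / (\<Prod>s\<in>T - {t}. t - s)) (B t))"
  have degB: "degree (B t) = card T - 1" if "t \<in> T" for t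
    unfolding B_def using that fin by (subst degree_prod_eq_sum_degree) (auto)
  have lcB: "coeff (B t) (card T - 1) = 1" if "t \<in> T" for t
  proof -
    have "lead_coeff (B t) = 1" unfolding B_def lead_coeff_prod by simp
    then show ?thesis using degB[OF that] by simp
  qed
  have polyB: "poly (B t) u = (if u = t then (\<Prod>s\<in>T - {t}. t - s) else 0)" if "t \<in> T" "u \<in> T" for t u
    using that fin unfolding B_def poly_prod by auto
  have polyP: "poly P u = u ^ r" if "u \<in> T" for u
  proof -
    have "poly P u = (\<Sum>t\<in>T. if t = u then u ^ r else 0)"
      unfolding P_def poly_sum poly_smult
    proof (intro sum.cong refl)
      fix t assume t: "t \<in> T"
      have "(\<Prod>s\<in>T - {t}. t - s) \<noteq> 0" using fin by auto
      then show "t ^ r / (\<Prod>s\<in>T - {t}. t - s) * poly (B t) u = (if t = u then u ^ r else 0)"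
        using polyB[OF t that] by auto
    qed
    then show ?thesis using that fin by simp
  qed
  have "P = monom 1 r"
  proof (rule poly_eqI_degree[of T])
    show "degree P < card T"
      unfolding P_def using r fin
      by (intro le_less_trans[OF degree_sum_le[of _ _ "card T - 1"]]) (auto simp: degB intro: order_trans[OF degree_smult_le])
  qed (use polyP r in \<open>auto simp: poly_monom degree_monom_eq\<close>)
  then have "coeff P (card T - 1) = 0" using r by (auto simp: coeff_monom)
  moreover have "coeff P (card T - 1) = (\<Sum>t\<in>T. t ^ r / (\<Prod>s\<in>T - {t}. t - s))"
    unfolding P_def coeff_sum coeff_smult by (intro sum.cong refl) (simp add: lcB[simplified])
  ultimately show ?thesis by simp
qed


section \<open>Products over differences of squares\<close>

lemma prod_square_differences:
  assumes "m < j"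
  shows "(\<Prod>i=1..m. (real j)\<^sup>2 - (real i)\<^sup>2) * fact (j - 1 - m) * fact j = fact (j - 1) * fact (j + m)"
  using assms
proof (induction m)
  case (Suc m)
  have "j - 1 - m = Suc (j - 1 - Suc m)" using Suc.prems by simp
  then have "(fact (j - 1 - m) :: real) = (real j - real (Suc m)) * fact (j - 1 - Suc m)"
    using Suc.prems by (simp add: fact_Suc del: fact_Suc) (simp add: fact_Suc of_nat_diff)
  then have IH: "(\<Prod>i=1..m. (real j)\<^sup>2 - (real i)\<^sup>2) * (real j - real (Suc m)) * fact (j - 1 - Suc m) * fact j
      = fact (j - 1) * fact (j + m)"
    using Suc by (simp add: mult_ac)
  \<comment> \<open>The new factor splits into a difference and a sum: the difference is the one
    already extracted from \<open>fact (j - 1 - m)\<close>, and the sum extends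
    \<open>fact (j + m)\<close>.\<close>
  have "(\<Prod>i=1..Suc m. (real j)\<^sup>2 - (real i)\<^sup>2) * fact (j - 1 - Suc m) * fact j
      = (real j + real (Suc m)) * ((\<Prod>i=1..m. (real j)\<^sup>2 - (real i)\<^sup>2) * (real j - real (Suc m)) * fact (j - 1 - Suc m) * fact j)"
    by (simp add: power2_eq_square algebra_simps)
  also have "\<dots> = (real j + real (Suc m)) * (fact (j - 1) * fact (j + m))"
    unfolding IH ..
  also have "\<dots> = fact (j - 1) * fact (j + Suc m)"
    by (simp add: algebra_simps)
  finally show ?case .
qed simp

text \<open>Induction on \<open>L\<close> from \<open>j\<close> upwards: at \<open>L = j\<close> all
  factors lie below \<open>j\<close> and \<open>prod_square_differences\<close> applies; each
  further \<open>L\<close> multiplies by \<open>L^2 / ((L - j) * (L + j))\<close>, which updates the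
  three factorials.\<close>

lemma prod_square_ratio_eq:
  assumes "1 \<le> j" "j \<le> L"
  shows "(\<Prod>i\<in>{1..L} - {j}. (real i)\<^sup>2 / \<bar>(real j)\<^sup>2 - (real i)\<^sup>2\<bar>)
    = 2 * (fact L)\<^sup>2 / (fact (L - j) * fact (L + j))"
  using assms(2)
proof (induction L rule: dec_induct)
  case base
  obtain m where m: "j = Suc m" using assms(1) by (cases j) auto
  have "{1..j} - {j} = {1..m}" using m by auto
  moreover have "(\<Prod>i=1..m. (real i)\<^sup>2 / \<bar>(real j)\<^sup>2 - (real i)\<^sup>2\<bar>)
      = (\<Prod>i=1..m. (real i)\<^sup>2) / (\<Prod>i=1..m. (real j)\<^sup>2 - (real i)\<^sup>2)"
    unfolding prod_dividef[symmetric]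
    by (intro prod.cong refl) (use m in \<open>auto simp: power_mono\<close>)
  moreover have "(\<Prod>i=1..m. (real i)\<^sup>2) = (fact m)\<^sup>2"
    by (simp add: fact_prod prod_power_distrib)
  moreover have "(\<Prod>i=1..m. (real j)\<^sup>2 - (real i)\<^sup>2) * fact j = fact m * fact (j + m)"
    using prod_square_differences[of m j] m by simp
  then have "(\<Prod>i=1..m. (real j)\<^sup>2 - (real i)\<^sup>2) = fact m * fact (j + m) / fact j"
    by (simp add: field_simps)
  moreover have "(fact m)\<^sup>2 / (fact m * fact (j + m) / fact j) = (2 * (fact j)\<^sup>2 / (fact (j - j) * fact (j + j)) :: real)"
  proof -
    have "(fact (j + j) :: real) = 2 * real j * fact (j + m)" by (simp add: m)
    moreover have "(fact j :: real) = real j * fact m" by (simp add: m)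
    moreover have "real j > 0" using m by simp
    ultimately show ?thesis by (simp add: power2_eq_square field_simps)
  qed
  ultimately show ?case by simp
next
  case (step L)
  have "{1..Suc L} - {j} = insert (Suc L) ({1..L} - {j})" using step by auto
  then have "(\<Prod>i\<in>{1..Suc L} - {j}. (real i)\<^sup>2 / \<bar>(real j)\<^sup>2 - (real i)\<^sup>2\<bar>)
      = (real (Suc L))\<^sup>2 / \<bar>(real j)\<^sup>2 - (real (Suc L))\<^sup>2\<bar> * (2 * (fact L)\<^sup>2 / (fact (L - j) * fact (L + j)))"
    using step by simp
  also have "\<bar>(real j)\<^sup>2 - (real (Suc L))\<^sup>2\<bar> = (real (Suc L) - real j) * (real (Suc L) + real j)"
  proof -
    have "(real j)\<^sup>2 \<le> (real (Suc L))\<^sup>2" using step by (intro power_mono) auto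
    then show ?thesis by (simp add: power2_eq_square algebra_simps)
  qed
  also have "(real (Suc L))\<^sup>2 / ((real (Suc L) - real j) * (real (Suc L) + real j)) * (2 * (fact L)\<^sup>2 / (fact (L - j) * fact (L + j)))
     = 2 * (fact (Suc L))\<^sup>2 / (fact (Suc L - j) * fact (Suc L + j))"
  proof -
    have "Suc L - j = Suc (L - j)" using step by simp
    then have 1: "(fact (Suc L - j) :: real) = (real (Suc L) - real j) * fact (L - j)"
      using step by (simp add: of_nat_diff)
    have 2: "(fact (Suc L + j) :: real) = (real (Suc L) + real j) * fact (L + j)" by simp
    have 3: "(fact (Suc L) :: real) = real (Suc L) * fact L" by simp
    show ?thesis unfolding 1 2 3 by (simp only: power_mult_distrib times_divide_times_eq mult_ac)
  qed
  finally show ?case .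
qed

text \<open>The closed form is twice a quotient of two binomial coefficients of
  \<open>2 * L\<close>, of which the central one is the largest.\<close>

lemma prod_square_ratio_le:
  assumes "1 \<le> j" "j \<le> L"
  shows "(\<Prod>i\<in>{1..L} - {j}. (real i)\<^sup>2 / \<bar>(real j)\<^sup>2 - (real i)\<^sup>2\<bar>) \<le> 2"
proof -
  have "real (2 * L choose (L - j)) \<le> real (2 * L choose L)"
    using binomial_maximum'[of L "L - j"] by simp
  moreover have "2 * L - (L - j) = L + j" "2 * L - L = L" using assms by auto
  ultimately have "fact (2 * L) / (fact (L - j) * fact (L + j)) \<le> (fact (2 * L) / (fact L * fact L) :: real)"
    using binomial_fact[of "L - j" "2 * L", where 'a = real] binomial_fact[of L "2 * L", where 'a = real]
    by (metis diff_le_self le_add1 le_trans mult_2)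
  then have "fact L * fact L \<le> (fact (L - j) * fact (L + j) :: real)"
    by (meson divide_strict_left_mono fact_gt_zero linorder_not_le mult_pos_pos)
  then show ?thesis
    unfolding prod_square_ratio_eq[OF assms] by (simp add: power2_eq_square field_simps)
qed

text \<open>The correction \<open>- 1 / real L\<close> lets the induction telescope, since
  \<open>1 / (L + 1)^2\<close> is at most \<open>1 / L - 1 / (L + 1)\<close>. The step from
  \<open>L = 0\<close> is separate because there \<open>1 / real L\<close> is
  \<open>0\<close>.\<close>

lemma sum_inverse_squares_le: "(\<Sum>j=1..L. 1 / (real j)\<^sup>2) \<le> 2 - 1 / real L"
proof (induction L)
  case (Suc L)
  have "1 / (real (Suc L))\<^sup>2 \<le> 1 / real L - 1 / real (Suc L)" if "L \<noteq> 0"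
  proof -
    have "1 / real L - 1 / real (Suc L) = 1 / (real L * real (Suc L))"
      using that by (simp add: field_simps)
    moreover have "1 / (real (Suc L) * real (Suc L)) \<le> 1 / (real L * real (Suc L))"
      using that by (intro divide_left_mono mult_right_mono) auto
    ultimately show ?thesis by (simp add: power2_eq_square)
  qed
  then show ?case using Suc by (cases "L = 0") auto
qed simp


lemma weierstrass_prod_ineq:
  fixes x :: "'i \<Rightarrow> 'b::linordered_idom"
  assumes "\<And>i. i \<in> I \<Longrightarrow> 0 \<le> x i \<and> x i \<le> 1"
  shows "1 - sum x I \<le> (\<Prod>i\<in>I. 1 - x i)"
  using assms
proof (induction I rule: infinite_finite_induct)
  case (insert i I)
  have "(1 - x i) * (1 - sum x I) \<le> (1 - x i) * (\<Prod>i\<in>I. 1 - x i)"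
    using insert by (intro mult_left_mono) auto
  moreover have "0 \<le> x i * sum x I"
    using insert by (intro mult_nonneg_nonneg sum_nonneg) auto
  ultimately show ?case using insert by (simp add: algebra_simps)
qed auto

text \<open>
  The weights \<open>\<nu>\<close> are the divided-difference weights of the nodes, normalised at \<open>0\<close>. On \<open>0\<close>, \<open>1\<close> and the
  \<open>4Mj\<^sup>2\<close> alone they would decay like \<open>1/j\<^sup>2\<close>, too slowly for a bounded mean; the extra node \<open>M\<close> makes the
  decay \<open>1/j\<^sup>4\<close>. Almost all the weight sits at \<open>0\<close> and \<open>1\<close>, with opposite signs.
\<close>

lemma moment_matching_weights:
  fixes M :: real
  assumes M: "2 \<le> M" and L: "1 \<le> L"
  defines "a \<equiv> \<lambda>j::nat. 4 * M * (real j)\<^sup>2"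
  defines "T \<equiv> {0, 1, M} \<union> a ` {1..L}"
  obtains \<nu> where "\<And>r. r \<le> L \<Longrightarrow> (\<Sum>t\<in>T. \<nu> t * t ^ r) = 0"
    and "\<nu> 0 = 1" and "\<nu> 1 \<le> 0" and "0 \<le> \<nu> M" and "\<nu> M \<le> 4 / M"
    and "\<And>j. 1 \<le> j \<Longrightarrow> j \<le> L \<Longrightarrow> \<bar>\<nu> (a j)\<bar> \<le> 2 / (9 * M * (real j)\<^sup>2 * (real j)\<^sup>2)"
proof -
  let ?J = "{1..L}"
  have fin: "finite T" by (simp add: T_def)
  have j1: "1 \<le> (real j)\<^sup>2" if "1 \<le> j" for j :: nat
    using that by (metis of_nat_1 of_nat_le_iff one_le_power)
  have aM: "4 * M \<le> a j" if "1 \<le> j" for j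
    using j1[OF that] M unfolding a_def by simp
  have a_big: "M < a j" "1 < a j" "0 < a j" if "1 \<le> j" for j
    using aM[OF that] M by linarith+
  have inj: "inj_on a ?J"
    using M by (auto simp: inj_on_def a_def)
  have notin: "0 \<notin> a ` ?J" "1 \<notin> a ` ?J" "M \<notin> a ` ?J"
    using a_big by (auto simp: image_iff) (metis less_irrefl)+
  have reindex: "prod g (a ` {Suc 0..L}) = (\<Prod>j=Suc 0..L. g (a j))" for g :: "real \<Rightarrow> real"
    using prod.reindex[OF inj, of g] by (simp add: o_def)
  \<comment> \<open>\<open>D t\<close> is the derivative at \<open>t\<close> of the monic polynomial
    with root set \<open>T\<close>, so \<open>1 / D t\<close> is a divided-difference
    weight.\<close>
  define D where "D t = (\<Prod>s\<in>T - {t}. t - s)" for t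
  have D0: "D 0 = M * (\<Prod>j\<in>?J. - a j)"
  proof -
    have "T - {0} = insert 1 (insert M (a ` ?J))" using M notin by (auto simp: T_def)
    then show ?thesis using M notin by (simp add: D_def reindex)
  qed
  have D1: "D 1 = (1 - M) * (\<Prod>j\<in>?J. 1 - a j)"
  proof -
    have "T - {1} = insert 0 (insert M (a ` ?J))" using M notin by (auto simp: T_def)
    then show ?thesis using M notin by (simp add: D_def reindex)
  qed
  have DM: "D M = M * ((M - 1) * (\<Prod>j\<in>?J. M - a j))"
  proof -
    have "T - {M} = insert 0 (insert 1 (a ` ?J))" using M notin by (auto simp: T_def)
    then show ?thesis using M notin by (simp add: D_def reindex)
  qed
  have Da: "D (a j) = a j * ((a j - 1) * ((a j - M) * (\<Prod>i\<in>?J - {j}. a j - a i)))" if j: "j \<in> ?J" for j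
  proof -
    have "a ` ?J - {a j} = a ` (?J - {j})"
      using inj_on_image_set_diff[OF inj, of ?J "{j}"] j by auto
    moreover have "a j \<notin> {0, 1, M}" using a_big[of j] j by auto
    ultimately have "T - {a j} = insert 0 (insert 1 (insert M (a ` (?J - {j}))))"
      by (auto simp: T_def)
    moreover have "inj_on a (?J - {j})" by (rule inj_on_subset[OF inj]) auto
    ultimately show ?thesis
      using M notin by (simp add: D_def prod.reindex o_def image_iff)
  qed
  define \<nu> where "\<nu> t = D 0 / D t" for t
  have D0_nz: "D 0 \<noteq> 0"
  proof -
    have "- a j \<noteq> 0" if "j \<in> ?J" for j using a_big[of j] that by simp
    then show ?thesis unfolding D0 using M by simp
  qed
  show thesis
  proof
    fix r assume "r \<le> L"
    have "card T = L + 3"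
    proof -
      have "card (a ` ?J) = L" using card_image[OF inj] by simp
      moreover have "T = insert 0 (insert 1 (insert M (a ` ?J)))" by (auto simp: T_def)
      ultimately show ?thesis using notin M by simp
    qed
    then have "(\<Sum>t\<in>T. t ^ r / D t) = 0"
      unfolding D_def using \<open>r \<le> L\<close> by (intro lagrange_leading_coefficient fin) simp
    then have "D 0 * (\<Sum>t\<in>T. t ^ r / D t) = 0" by simp
    then show "(\<Sum>t\<in>T. \<nu> t * t ^ r) = 0"
      by (simp add: \<nu>_def sum_distrib_left mult_ac)
  next
    show "\<nu> 0 = 1" using D0_nz by (simp add: \<nu>_def)
  next
    have "\<nu> 1 = M / (1 - M) * (\<Prod>j\<in>?J. - a j / (1 - a j))"
      unfolding \<nu>_def D0 D1 prod_dividef by (simp only: times_divide_times_eq)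
    moreover have "0 \<le> (\<Prod>j\<in>?J. - a j / (1 - a j))"
    proof (intro prod_nonneg divide_nonpos_neg)
      fix j assume "j \<in> ?J"
      then show "- a j \<le> 0" "1 - a j < 0" using a_big[of j] by simp_all
    qed
    ultimately show "\<nu> 1 \<le> 0"
      using M by (simp add: mult_nonpos_nonneg divide_nonneg_neg)
  next
    have eq: "\<nu> M = 1 / (M - 1) * (\<Prod>j\<in>?J. - a j / (M - a j))"
      using M unfolding \<nu>_def D0 DM prod_dividef times_divide_times_eq by simp
    \<comment> \<open>\<open>M\<close> cancels. The factor 4 in the nodes makes the sum of the
      \<open>1 / (4 * j^2)\<close> at most 1/2, which keeps the product of the denominators above
      1/2.\<close>
    have *: "- a j / (M - a j) = 1 / (1 - 1 / (4 * (real j)\<^sup>2))" if "j \<in> ?J" for j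
      using that a_big[of j] M by (simp add: a_def divide_simps) (auto simp: field_simps)
    have half: "1 / 2 \<le> (\<Prod>j\<in>?J. 1 - 1 / (4 * (real j)\<^sup>2))"
    proof -
      have "1 - (\<Sum>j\<in>?J. 1 / (4 * (real j)\<^sup>2)) \<le> (\<Prod>j\<in>?J. 1 - 1 / (4 * (real j)\<^sup>2))"
        proof (intro weierstrass_prod_ineq)
        fix j assume "j \<in> ?J"
        then have "1 \<le> 4 * (real j)\<^sup>2" using j1[of j] unfolding atLeastAtMost_iff by linarith
        then show "0 \<le> 1 / (4 * (real j)\<^sup>2) \<and> 1 / (4 * (real j)\<^sup>2) \<le> 1"
          by (auto simp: divide_le_eq_1)
      qed
      moreover have "(\<Sum>j\<in>?J. 1 / (4 * (real j)\<^sup>2)) = (\<Sum>j\<in>?J. 1 / (real j)\<^sup>2) / 4"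
        by (simp add: sum_divide_distrib mult.commute)
      moreover have "1 / real L \<ge> 0" by simp
      ultimately show ?thesis using sum_inverse_squares_le[of L] by linarith
    qed
    have "\<nu> M = 1 / (M - 1) * (1 / (\<Prod>j\<in>?J. 1 - 1 / (4 * (real j)\<^sup>2)))"
    proof -
      have "(\<Prod>j\<in>?J. - a j / (M - a j)) = (\<Prod>j\<in>?J. 1 / (1 - 1 / (4 * (real j)\<^sup>2)))"
        by (rule prod.cong[OF refl *])
      then show ?thesis unfolding eq prod_dividef by simp
    qed
    moreover have "1 / (\<Prod>j\<in>?J. 1 - 1 / (4 * (real j)\<^sup>2)) \<le> 2" "1 / (\<Prod>j\<in>?J. 1 - 1 / (4 * (real j)\<^sup>2)) \<ge> 0"
      using half by (simp_all add: divide_simps)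
    moreover have "1 / (M - 1) \<le> 2 / M" using M by (simp add: divide_simps)
    moreover have "0 \<le> 1 / (M - 1)" using M by simp
    moreover have "A * B \<le> 2 / M * 2" if "B \<le> 2" "0 \<le> B" "A \<le> 2 / M" "0 \<le> A" for A B :: real
      using that M by (intro mult_mono) auto
    ultimately have "\<nu> M \<le> 2 / M * 2" "0 \<le> \<nu> M"
      by (simp_all only: mult_nonneg_nonneg)
    then show "0 \<le> \<nu> M" "\<nu> M \<le> 4 / M" by simp_all
  next
    fix j assume j: "1 \<le> j" "j \<le> L"
    let ?x = "(real j)\<^sup>2"
    have jJ: "j \<in> ?J" using j by simp
    have "(\<Prod>i\<in>?J. - a i) = - a j * (\<Prod>i\<in>?J - {j}. - a i)"
      using jJ by (simp add: prod.remove)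
    then have "\<nu> (a j) = - M / ((a j - 1) * (a j - M)) * (\<Prod>i\<in>?J - {j}. - a i / (a j - a i))"
      using a_big[OF j(1)] unfolding \<nu>_def D0 Da[OF jJ] prod_dividef times_divide_times_eq
      by (simp add: mult_ac)
    then have "\<bar>\<nu> (a j)\<bar> = M / ((a j - 1) * (a j - M)) * (\<Prod>i\<in>?J - {j}. \<bar>- a i / (a j - a i)\<bar>)"
      using a_big[OF j(1)] M by (simp add: abs_mult abs_prod)
    also have "(\<Prod>i\<in>?J - {j}. \<bar>- a i / (a j - a i)\<bar>) = (\<Prod>i\<in>?J - {j}. (real i)\<^sup>2 / \<bar>(real j)\<^sup>2 - (real i)\<^sup>2\<bar>)"
    proof (intro prod.cong refl)
      fix i
      \<comment> \<open>The common scale \<open>4 * M\<close> of the nodes cancels, leaving the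
        ratios bounded by \<open>prod_square_ratio_le\<close>.\<close>
      have "a j - a i = 4 * M * ((real j)\<^sup>2 - (real i)\<^sup>2)" by (simp add: a_def algebra_simps)
      then have "- a i / (a j - a i) = - ((real i)\<^sup>2 / ((real j)\<^sup>2 - (real i)\<^sup>2))"
        using M by (simp add: a_def)
      then show "\<bar>- a i / (a j - a i)\<bar> = (real i)\<^sup>2 / \<bar>(real j)\<^sup>2 - (real i)\<^sup>2\<bar>"
        by (simp only: abs_minus abs_divide) simp
    qed
    also have "M / ((a j - 1) * (a j - M)) * \<dots> \<le> M / ((a j - 1) * (a j - M)) * 2"
      using a_big[OF j(1)] M by (intro mult_left_mono prod_square_ratio_le j) auto
    also have "\<dots> \<le> M / ((3 * M * ?x) * (3 * M * ?x)) * 2"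
    proof -
      \<comment> \<open>Lowering 4 to 3 pays for subtracting \<open>1\<close> or \<open>M\<close>
        from \<open>a j\<close>.\<close>
      have "M \<le> M * ?x" using j1[OF j(1)] M by simp
      then have "3 * M * ?x \<le> a j - 1" "3 * M * ?x \<le> a j - M" "0 < 3 * M * ?x"
        unfolding a_def using M by linarith+
      moreover have "M / (y * z) * 2 \<le> M / (x * x) * 2" if "x \<le> y" "x \<le> z" "0 < x" for x y z
        using that M by (intro mult_right_mono divide_left_mono mult_mono mult_pos_pos) auto
      ultimately show ?thesis by blast
    qed
    also have "\<dots> = 2 / (9 * M * ?x * ?x)" using M by (simp add: field_simps)
    finally show "\<bar>\<nu> (a j)\<bar> \<le> 2 / (9 * M * (real j)\<^sup>2 * (real j)\<^sup>2)" .
  qed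
qed


lemma sum_mono_subset:
  fixes f g :: "'i \<Rightarrow> 'b::ordered_comm_monoid_add"
  assumes "finite B" "A \<subseteq> B" "\<And>x. x \<in> A \<Longrightarrow> f x \<le> g x" "\<And>x. x \<in> B \<Longrightarrow> 0 \<le> g x"
  shows "sum f A \<le> sum g B"
  by (rule order_trans[OF sum_mono[of A f g] sum_mono2]) (use assms in auto)

text \<open>The laws are the normalised positive and negative parts of \<nu>. Both parts have the
  same mass \<open>Z\<close> because the zeroth moment of \<nu> vanishes, and \<open>Z\<close> is at
  least 1 because \<open>\<nu> 0 = 1\<close>, so normalising preserves the upper bounds. A large
  \<open>M\<close> leaves little mass of \<alpha> off 0 and of \<beta> off 1.\<close>

lemma matching_moments_exist:
  fixes M :: real
  assumes M: "2 \<le> M" and L: "1 \<le> L"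
  obtains T :: "real set" and \<alpha> \<beta> :: "real \<Rightarrow> real"
  where "finite T" "0 \<in> T" "1 \<in> T" "\<And>t. t \<in> T \<Longrightarrow> 0 \<le> t \<and> t \<le> 4 * M * (real L)\<^sup>2"
    and "\<And>t. 0 \<le> \<alpha> t" "sum \<alpha> T = 1" "\<And>t. 0 \<le> \<beta> t" "sum \<beta> T = 1"
    and "\<And>r. r \<le> L \<Longrightarrow> (\<Sum>t\<in>T. (\<alpha> t - \<beta> t) * t ^ r) = 0"
    and "sum \<alpha> (T - {0}) \<le> 5 / M" "sum \<beta> (T - {1}) \<le> 1 / M"
    and "(\<Sum>t\<in>T. \<alpha> t * t) \<le> 6" "(\<Sum>t\<in>T. \<beta> t * t) \<le> 6"
proof -
  define a where "a = (\<lambda>j::nat. 4 * M * (real j)\<^sup>2)"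
  define T where "T = {0, 1, M} \<union> a ` {1..L}"
  obtain \<nu> where \<nu>: "\<And>r. r \<le> L \<Longrightarrow> (\<Sum>t\<in>T. \<nu> t * t ^ r) = 0"
    and \<nu>0: "\<nu> 0 = 1" and \<nu>1: "\<nu> 1 \<le> 0" and \<nu>M: "0 \<le> \<nu> M" "\<nu> M \<le> 4 / M"
    and \<nu>a: "\<And>j. 1 \<le> j \<Longrightarrow> j \<le> L \<Longrightarrow> \<bar>\<nu> (a j)\<bar> \<le> 2 / (9 * M * (real j)\<^sup>2 * (real j)\<^sup>2)"
    using moment_matching_weights[OF M L] unfolding T_def a_def by blast
  have fin: "finite T" by (simp add: T_def)
  have mem: "0 \<in> T" "1 \<in> T" "M \<in> T" by (auto simp: T_def)
  have j1: "1 \<le> (real j)\<^sup>2" if "1 \<le> j" for j :: nat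
    using that by (metis of_nat_1 of_nat_le_iff one_le_power)
  have range: "0 \<le> t \<and> t \<le> 4 * M * (real L)\<^sup>2" if "t \<in> T" for t
  proof -
    have "4 * M * 1 \<le> 4 * M * (real L)\<^sup>2" using M j1[OF L] by (intro mult_left_mono) auto
    then have "1 \<le> 4 * M * (real L)\<^sup>2" "M \<le> 4 * M * (real L)\<^sup>2" using M by linarith+
    moreover have "a j \<le> 4 * M * (real L)\<^sup>2" "0 \<le> a j" if "j \<le> L" for j
      using that M unfolding a_def by (auto intro!: mult_left_mono power_mono)
    moreover have "t \<in> {0, 1, M} \<or> (\<exists>j\<le>L. t = a j)" using that by (auto simp: T_def)
    ultimately show ?thesis using M by (elim disjE insertE exE conjE emptyE; simp only:; linarith)
  qed
  have T_eq: "T = insert 0 (insert 1 (insert M (a ` {1..L})))" by (auto simp: T_def)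
  have sum_a: "sum g (a ` {1..L}) \<le> (\<Sum>j=1..L. g (a j))" if "\<And>t. 0 \<le> g t" for g :: "real \<Rightarrow> real"
    using sum_image_le[OF finite_atLeastAtMost, of 1 L g a] that by (simp only: o_def)
  have small: "(\<Sum>t\<in>a ` {1..L}. \<bar>\<nu> t\<bar>) \<le> 1 / M"
  proof -
    have "(\<Sum>t\<in>a ` {1..L}. \<bar>\<nu> t\<bar>) \<le> (\<Sum>j=1..L. \<bar>\<nu> (a j)\<bar>)" by (rule sum_a) simp
    also have "\<dots> \<le> (\<Sum>j=1..L. 1 / (2 * M) * (1 / (real j)\<^sup>2))"
    proof (rule sum_mono)
      fix j assume j: "j \<in> {1..L}"
      have "2 / (9 * M * (real j)\<^sup>2 * (real j)\<^sup>2) \<le> 2 / (9 * M * (real j)\<^sup>2 * 1)"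
        using j j1[of j] M by (intro divide_left_mono mult_left_mono mult_pos_pos) auto
      also have "\<dots> \<le> 1 / (2 * M) * (1 / (real j)\<^sup>2)"
        using j M by (simp add: field_simps)
      finally show "\<bar>\<nu> (a j)\<bar> \<le> 1 / (2 * M) * (1 / (real j)\<^sup>2)"
        using \<nu>a[of j] j by simp
    qed
    also have "\<dots> = 1 / (2 * M) * (\<Sum>j=1..L. 1 / (real j)\<^sup>2)" by (simp add: sum_distrib_left)
    also have "\<dots> \<le> 1 / (2 * M) * 2"
      using sum_inverse_squares_le[of L] M by (intro mult_left_mono) (auto intro: order_trans)
    finally show ?thesis by simp
  qed
  \<comment> \<open>Here the decay \<open>1/j^4\<close> of the weights matters: against nodes
    growing like \<open>j^2\<close> it still leaves a summable \<open>1/j^2\<close>.\<close>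
  have small_mean: "(\<Sum>t\<in>a ` {1..L}. \<bar>\<nu> t\<bar> * \<bar>t\<bar>) \<le> 2"
  proof -
    have "(\<Sum>t\<in>a ` {1..L}. \<bar>\<nu> t\<bar> * \<bar>t\<bar>) \<le> (\<Sum>j=1..L. \<bar>\<nu> (a j)\<bar> * \<bar>a j\<bar>)" by (rule sum_a) simp
    also have "\<dots> \<le> (\<Sum>j=1..L. 1 / (real j)\<^sup>2)"
    proof (rule sum_mono)
      fix j assume j: "j \<in> {1..L}"
      have "\<bar>\<nu> (a j)\<bar> * \<bar>a j\<bar> \<le> 2 / (9 * M * (real j)\<^sup>2 * (real j)\<^sup>2) * \<bar>a j\<bar>"
        using \<nu>a[of j] j by (intro mult_right_mono) auto
      also have "\<dots> \<le> 1 / (real j)\<^sup>2"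
      proof -
        have "2 / (9 * M * x * x) * (4 * M * x) \<le> 1 / x" if "0 < x" for x :: real
          using that M by (simp add: divide_simps)
        from this[of "(real j)\<^sup>2"] show ?thesis using j M by (simp add: a_def)
      qed
      finally show "\<bar>\<nu> (a j)\<bar> * \<bar>a j\<bar> \<le> 1 / (real j)\<^sup>2" .
    qed
    also have "\<dots> \<le> 2"
      using sum_inverse_squares_le[of L] by (rule order_trans) simp
    finally show ?thesis .
  qed
  define Z where "Z = (\<Sum>t\<in>T. max (\<nu> t) 0)"
  have Z1: "1 \<le> Z"
    unfolding Z_def using \<nu>0 member_le_sum[OF mem(1), of "\<lambda>t. max (\<nu> t) 0"] fin by simp
  have Z': "Z = (\<Sum>t\<in>T. max (- \<nu> t) 0)"
  proof -
    have "Z - (\<Sum>t\<in>T. max (- \<nu> t) 0) = (\<Sum>t\<in>T. \<nu> t * t ^ 0)"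
      unfolding Z_def sum_subtractf[symmetric] by (intro sum.cong) (auto simp: max_def)
    then show ?thesis using \<nu>[of 0] by simp
  qed
  define \<alpha> where "\<alpha> t = max (\<nu> t) 0 / Z" for t
  define \<beta> where "\<beta> t = max (- \<nu> t) 0 / Z" for t
  have div_Z: "x / Z \<le> y" if "x \<le> y" "0 \<le> y" for x y
  proof -
    have "y * 1 \<le> y * Z" using that Z1 by (intro mult_left_mono) auto
    then have "x \<le> y * Z" using that by linarith
    then show ?thesis using Z1 by (simp add: divide_le_eq)
  qed
  have diff: "\<alpha> t - \<beta> t = \<nu> t / Z" for t
    by (auto simp: \<alpha>_def \<beta>_def max_def diff_divide_distrib[symmetric])
  have match: "(\<Sum>t\<in>T. (\<alpha> t - \<beta> t) * t ^ r) = 0" if "r \<le> L" for r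
    using \<nu>[OF that] unfolding diff by (simp add: sum_divide_distrib[symmetric])
  have mean_\<alpha>: "(\<Sum>t\<in>T. \<alpha> t * t) \<le> 6"
  proof -
    have "(\<Sum>t\<in>T. max (\<nu> t) 0 * t) = (\<Sum>t\<in>T - {0, 1}. max (\<nu> t) 0 * t)"
      using fin \<nu>1 by (intro sum.mono_neutral_right) auto
    also have "\<dots> \<le> (\<Sum>t\<in>insert M (a ` {1..L}). \<bar>\<nu> t\<bar> * \<bar>t\<bar>)"
      by (rule sum_mono_subset) (auto simp: T_eq range dest: range[unfolded T_eq, simplified] intro!: mult_mono)
    also have "\<dots> \<le> \<bar>\<nu> M\<bar> * \<bar>M\<bar> + (\<Sum>t\<in>a ` {1..L}. \<bar>\<nu> t\<bar> * \<bar>t\<bar>)"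
      by (simp add: sum.insert_if)
    also have "\<bar>\<nu> M\<bar> * \<bar>M\<bar> \<le> 4"
      using \<nu>M M by (simp add: field_simps)
    finally have "(\<Sum>t\<in>T. max (\<nu> t) 0 * t) \<le> 6" using small_mean by linarith
    then have "(\<Sum>t\<in>T. max (\<nu> t) 0 * t) / Z \<le> 6" by (rule div_Z) simp
    then show ?thesis by (simp add: \<alpha>_def sum_divide_distrib)
  qed
  show thesis
  proof
    show "sum \<alpha> T = 1" "sum \<beta> T = 1"
      using Z1 Z' by (simp_all add: \<alpha>_def \<beta>_def sum_divide_distrib[symmetric] Z_def[symmetric])
    show "0 \<le> \<alpha> t" "0 \<le> \<beta> t" for t using Z1 by (simp_all add: \<alpha>_def \<beta>_def)
    \<comment> \<open>The first moments agree, since \<open>1 \<le> L\<close>.\<close>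
    show "(\<Sum>t\<in>T. \<beta> t * t) \<le> 6"
      using match[OF L] mean_\<alpha> by (simp add: left_diff_distrib sum_subtractf)
    have "(\<Sum>t\<in>T - {0}. max (\<nu> t) 0) = (\<Sum>t\<in>T - {0, 1}. max (\<nu> t) 0)"
      using fin \<nu>1 by (intro sum.mono_neutral_right) auto
    also have "\<dots> \<le> (\<Sum>t\<in>insert M (a ` {1..L}). \<bar>\<nu> t\<bar>)"
      by (rule sum_mono_subset) (auto simp: T_eq range dest: range[unfolded T_eq, simplified] intro!: mult_mono)
    also have "\<dots> \<le> \<bar>\<nu> M\<bar> + (\<Sum>t\<in>a ` {1..L}. \<bar>\<nu> t\<bar>)"
      by (simp add: sum.insert_if)
    also have "\<dots> \<le> 4 / M + 1 / M" using small \<nu>M by linarith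
    finally have "(\<Sum>t\<in>T - {0}. max (\<nu> t) 0) \<le> 5 / M" by simp
    then have "(\<Sum>t\<in>T - {0}. max (\<nu> t) 0) / Z \<le> 5 / M" using M by (intro div_Z) auto
    then show "sum \<alpha> (T - {0}) \<le> 5 / M" by (simp add: \<alpha>_def sum_divide_distrib)
    \<comment> \<open>\<nu> is nonnegative at \<open>0\<close> and \<open>M\<close>, so \<beta>
      charges neither.\<close>
    have "(\<Sum>t\<in>T - {1}. max (- \<nu> t) 0) = (\<Sum>t\<in>T - {0, 1, M}. max (- \<nu> t) 0)"
      using fin \<nu>0 \<nu>M by (intro sum.mono_neutral_right) auto
    also have "\<dots> \<le> (\<Sum>t\<in>a ` {1..L}. \<bar>\<nu> t\<bar>)"
      by (rule sum_mono_subset) (auto simp: T_eq range dest: range[unfolded T_eq, simplified] intro!: mult_mono)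
    also have "\<dots> \<le> 1 / M" by (rule small)
    finally have "(\<Sum>t\<in>T - {1}. max (- \<nu> t) 0) / Z \<le> 1 / M" using M by (intro div_Z) auto
    then show "sum \<beta> (T - {1}) \<le> 1 / M" by (simp add: \<beta>_def sum_divide_distrib)
  qed (use fin mem range match mean_\<alpha> in auto)
qed

section \<open>Intersections of halfspaces on the moment curve\<close>

text \<open>The exponents start at 1 because the threshold \<open>w0\<close> of a halfspace provides
  the constant term; \<open>restrict\<close> makes the values extensional, hence points of
  \<open>Rn n\<close>.\<close>

definition curve :: "nat \<Rightarrow> nat \<Rightarrow> nat \<Rightarrow> real" where
  "curve n t = (\<lambda>i\<in>{..<n}. real t ^ Suc i)"

lemma curve_in_space: "curve n t \<in> space (Rn n)"
  by (simp add: curve_def Rn_def space_PiM)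

lemma curve_inj: "n \<ge> 1 \<Longrightarrow> curve n s = curve n t \<longleftrightarrow> s = t"
proof
  assume "n \<ge> 1" "curve n s = curve n t"
  then have "curve n s 0 = curve n t 0" by simp
  then show "s = t" using \<open>n \<ge> 1\<close> by (simp add: curve_def)
qed simp

text \<open>The restriction of an affine form to the moment curve, which turns changes of sign into
  roots of a polynomial of degree at most \<open>n\<close>.\<close>

definition affine_poly :: "nat \<Rightarrow> real \<Rightarrow> (nat \<Rightarrow> real) \<Rightarrow> real poly" where
  "affine_poly n w0 w = [:w0:] + (\<Sum>i<n. monom (w i) (Suc i))"

lemma poly_affine_poly: "poly (affine_poly n w0 w) (real t) = w0 + (\<Sum>i<n. w i * curve n t i)"
  by (simp add: affine_poly_def poly_sum poly_monom curve_def)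

lemma degree_affine_poly: "degree (affine_poly n w0 w) \<le> n"
  unfolding affine_poly_def
  by (intro degree_add_le degree_sum_le) (auto intro: order_trans[OF degree_monom_le])

lemma halfspace_of_poly:
  assumes "degree P \<le> n"
  shows "\<exists>h\<in>halfspaces n. \<forall>t. h (curve n t) \<longleftrightarrow> 0 \<le> poly P (real t)"
proof -
  let ?w = "\<lambda>i. coeff P (Suc i)"
  have "poly P (real t) = coeff P 0 + (\<Sum>i<n. ?w i * curve n t i)" for t
  proof -
    have "poly P (real t) = (\<Sum>i\<le>n. coeff P i * real t ^ i)"
      unfolding poly_altdef using assms
      by (intro sum.mono_neutral_left) (auto simp: coeff_eq_0)
    also have "\<dots> = coeff P 0 + (\<Sum>i<n. coeff P (Suc i) * real t ^ Suc i)"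
      by (simp add: lessThan_Suc_atMost[symmetric] sum.lessThan_Suc_shift del: sum.lessThan_Suc)
    finally show ?thesis by (simp add: curve_def)
  qed
  then show ?thesis
    by (intro bexI[of _ "\<lambda>x. coeff P 0 + (\<Sum>i<n. ?w i * x i) \<ge> 0"]) (auto simp: halfspaces_def)
qed

text \<open>
  The polynomial \<open>\<Prod>(t - a)\<^sup>2 - 1/2\<close> is negative exactly on \<open>F\<close> among the integers.
\<close>

lemma halfspace_excludes:
  assumes "finite F" "2 * card F \<le> n"
  shows "\<exists>h\<in>halfspaces n. \<forall>t. h (curve n t) \<longleftrightarrow> t \<notin> F"
proof -
  define P :: "real poly" where "P = (\<Prod>a\<in>F. [:- real a, 1:] ^ 2) - [:1/2:]"
  have "degree (\<Prod>a\<in>F. [:- real a, 1:] ^ 2) \<le> (\<Sum>a\<in>F. 2)"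
    by (rule order_trans[OF degree_prod_sum_le sum_mono]) (use assms in \<open>auto simp: degree_power_eq\<close>)
  then have deg: "degree P \<le> n"
    unfolding P_def using assms by (intro degree_diff_le) auto
  have "0 \<le> poly P (real t) \<longleftrightarrow> t \<notin> F" for t
  proof (cases "t \<in> F")
    case True
    then have "(\<Prod>a\<in>F. (real t - real a)\<^sup>2) = 0" using assms by auto
    then show ?thesis using True by (simp add: P_def poly_prod)
  next
    case False
    have "1 \<le> (\<Prod>a\<in>F. (real t - real a)\<^sup>2)"
    proof (rule prod_ge_1)
      fix a assume "a \<in> F"
      then have "int t - int a \<noteq> 0" using False by auto
      then have "1 \<le> (int t - int a)\<^sup>2"
        by (smt (verit) zero_less_power2)
      then have "real_of_int 1 \<le> real_of_int ((int t - int a)\<^sup>2)" by (simp only: of_int_le_iff)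
      then show "1 \<le> (real t - real a)\<^sup>2" by simp
    qed
    then show ?thesis using False by (simp add: P_def poly_prod)
  qed
  then show ?thesis using halfspace_of_poly[OF deg] by auto
qed

text \<open>Blocks of up to \<open>m\<close> elements are split off greedily. With
  \<open>m = n div 2\<close>, a block is what a single halfspace can exclude.\<close>

lemma finite_partition_bounded:
  assumes "finite F" "card F \<le> k * m"
  shows "\<exists>G :: nat \<Rightarrow> 'b set. F = (\<Union>j<k. G j) \<and> (\<forall>j<k. finite (G j) \<and> card (G j) \<le> m)"
  using assms
proof (induction k arbitrary: F)
  case 0
  then show ?case by simp
next
  case (Suc k)
  obtain H where H: "H \<subseteq> F" "card H = min m (card F)"
    by (rule obtain_subset_with_card_n[of "min m (card F)" F]) simp_all
  then have finH: "finite H" using Suc.prems finite_subset by blast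
  have "card (F - H) = card F - min m (card F)"
    using H finH by (simp add: card_Diff_subset)
  then have "card (F - H) \<le> k * m" using Suc.prems by auto
  then obtain G where G: "F - H = (\<Union>j<k. G j)" "\<forall>j<k. finite (G j) \<and> card (G j) \<le> m"
    using Suc.IH[of "F - H"] Suc.prems by auto
  show ?case
  proof (intro exI[of _ "G(k := H)"] conjI)
    show "F = (\<Union>j<Suc k. (G(k := H)) j)"
      using H(1) G(1) by (auto simp: lessThan_Suc)
    show "\<forall>j<Suc k. finite ((G(k := H)) j) \<and> card ((G(k := H)) j) \<le> m"
      using G(2) H(2) finH by (auto simp: less_Suc_eq)
  qed
qed

lemma halfspace_intersection_excludes:
  assumes "finite F" "card F \<le> k * (n div 2)"
  shows "\<exists>h\<in>halfspace_intersections n k. \<forall>t. h (curve n t) \<longleftrightarrow> t \<notin> F"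
proof -
  obtain G where G: "F = (\<Union>j<k. G j)" "\<forall>j<k. finite (G j) \<and> card (G j) \<le> n div 2"
    using finite_partition_bounded[OF assms] by blast
  have "\<forall>j\<in>{..<k}. \<exists>h. h \<in> halfspaces n \<and> (\<forall>t. h (curve n t) \<longleftrightarrow> t \<notin> G j)"
  proof
    fix j assume "j \<in> {..<k}"
    then have "finite (G j)" "2 * card (G j) \<le> n" using G(2) by auto
    then show "\<exists>h. h \<in> halfspaces n \<and> (\<forall>t. h (curve n t) \<longleftrightarrow> t \<notin> G j)"
      using halfspace_excludes by blast
  qed
  from bchoice[OF this] obtain h where
    h: "\<forall>j\<in>{..<k}. h j \<in> halfspaces n \<and> (\<forall>t. h j (curve n t) \<longleftrightarrow> t \<notin> G j)" by blast
  then show ?thesis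
    by (intro bexI[of _ "\<lambda>x. \<forall>j<k. h j x"]) (auto simp: halfspace_intersections_def G(1))
qed

section \<open>Sign changes along the moment curve\<close>

lemma card_sign_changes_le:
  assumes "degree P \<le> n"
  shows "card {i. i < p \<and> 0 \<le> poly P (real (2 * i)) \<and> poly P (real (2 * i + 1)) < 0} \<le> n"
    (is "card ?S \<le> n")
proof (cases "P = 0")
  case False
  \<comment> \<open>Each descent forces a root. The intervals are closed on the left because a root
    at \<open>2 * i\<close> already counts as nonnegative, and open on the right to keep the roots
    distinct.\<close>
  have "\<forall>i\<in>?S. \<exists>x. real (2 * i) \<le> x \<and> x < real (2 * i + 1) \<and> poly P x = 0"
  proof
    fix i assume i: "i \<in> ?S"
    show "\<exists>x. real (2 * i) \<le> x \<and> x < real (2 * i + 1) \<and> poly P x = 0"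
    proof (cases "poly P (real (2 * i)) = 0")
      case True
      then show ?thesis by (intro exI[of _ "real (2 * i)"]) simp
    next
      case False
      then have "0 < poly P (real (2 * i))" "poly P (real (2 * i + 1)) < 0" using i by auto
      then obtain x where "real (2 * i) < x" "x < real (2 * i + 1)" "poly P x = 0"
        using poly_IVT_neg[of "real (2 * i)" "real (2 * i + 1)" P] by auto
      then show ?thesis by (intro exI[of _ x]) linarith
    qed
  qed
  from bchoice[OF this] obtain x where
    x: "\<forall>i\<in>?S. real (2 * i) \<le> x i \<and> x i < real (2 * i + 1) \<and> poly P (x i) = 0" by blast
  have "inj_on x ?S"
  proof (rule inj_onI)
    fix i j assume "i \<in> ?S" "j \<in> ?S" "x i = x j"
    then have "real (2 * i) < real (2 * j + 1)" "real (2 * j) < real (2 * i + 1)"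
      using bspec[OF x \<open>i \<in> ?S\<close>] bspec[OF x \<open>j \<in> ?S\<close>] by linarith+
    then have "2 * i < 2 * j + 1" "2 * j < 2 * i + 1" by linarith+
    then show "i = j" by simp
  qed
  then have "card ?S = card (x ` ?S)" by (simp add: card_image)
  also have "\<dots> \<le> card {y. poly P y = 0}"
    using x by (intro card_mono poly_roots_finite[OF False]) auto
  also have "\<dots> \<le> degree P" by (rule card_poly_roots_bound[OF False])
  finally show ?thesis using assms by simp
qed simp

text \<open>If the conjunction holds at \<open>2 * i\<close> and fails at \<open>2 * i + 1\<close>,
  then one of the \<open>k\<close> halfspaces fails at the latter, while all of them hold at the
  former. So every descent of \<open>h\<close> is a descent of some \<open>g j\<close>, and each
  \<open>g j\<close> has at most \<open>n\<close>.\<close>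

lemma card_alternations_le:
  assumes "h \<in> halfspace_intersections n k"
  shows "card {i. i < p \<and> h (curve n (2 * i)) \<and> \<not> h (curve n (2 * i + 1))} \<le> k * n"
proof -
  obtain g where g: "\<forall>j<k. g j \<in> halfspaces n" and h: "h = (\<lambda>x. \<forall>j<k. g j x)"
    using assms by (auto simp: halfspace_intersections_def)
  have "card {i. i < p \<and> g j (curve n (2 * i)) \<and> \<not> g j (curve n (2 * i + 1))} \<le> n" if jk: "j < k" for j
  proof -
    obtain w0 w where "g j = (\<lambda>x. w0 + (\<Sum>i<n. w i * x i) \<ge> 0)"
      using g[rule_format, OF jk] unfolding halfspaces_def by blast
    then show ?thesis
      using card_sign_changes_le[OF degree_affine_poly[of n w0 w], of p]
      by (simp only: poly_affine_poly not_le)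
  qed
  then have "(\<Sum>j<k. card {i. i < p \<and> g j (curve n (2 * i)) \<and> \<not> g j (curve n (2 * i + 1))}) \<le> (\<Sum>j<k. n)"
    by (intro sum_mono) auto
  moreover have "{i. i < p \<and> h (curve n (2 * i)) \<and> \<not> h (curve n (2 * i + 1))}
      \<subseteq> (\<Union>j<k. {i. i < p \<and> g j (curve n (2 * i)) \<and> \<not> g j (curve n (2 * i + 1))})"
    unfolding h by auto
  then have "card {i. i < p \<and> h (curve n (2 * i)) \<and> \<not> h (curve n (2 * i + 1))}
      \<le> card (\<Union>j<k. {i. i < p \<and> g j (curve n (2 * i)) \<and> \<not> g j (curve n (2 * i + 1))})"
    by (intro card_mono) auto
  moreover have "\<dots> \<le> (\<Sum>j<k. card {i. i < p \<and> g j (curve n (2 * i)) \<and> \<not> g j (curve n (2 * i + 1))})"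
    by (rule card_UN_le) simp
  ultimately show ?thesis by simp
qed

lemma halfspace_intersection_measurable:
  assumes "h \<in> halfspace_intersections n k"
  shows "h \<in> measurable (Rn n) (count_space UNIV)"
proof -
  obtain g where g: "\<forall>j<k. g j \<in> halfspaces n" and h: "h = (\<lambda>x. \<forall>j<k. g j x)"
    using assms by (auto simp: halfspace_intersections_def)
  have "Measurable.pred (Rn n) (g j)" if jk: "j < k" for j
  proof -
    obtain w0 w where eq: "g j = (\<lambda>x. w0 + (\<Sum>i<n. w i * x i) \<ge> 0)"
      using g[rule_format, OF jk] unfolding halfspaces_def by blast
    have "(\<lambda>x. x i) \<in> borel_measurable (Rn n)" if "i < n" for i
      unfolding Rn_def using that by (intro measurable_component_singleton) auto
    then have "(\<lambda>x. w0 + (\<Sum>i<n. w i * x i)) \<in> borel_measurable (Rn n)"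
      by (intro borel_measurable_add borel_measurable_sum borel_measurable_times) auto
    then show ?thesis unfolding eq by measurable
  qed
  then have "Measurable.pred (Rn n) (\<lambda>x. \<forall>j\<in>{..<k}. g j x)"
    by (intro pred_intros_finite) auto
  then show ?thesis unfolding h by (simp only: Ball_def lessThan_iff)
qed

section \<open>Samples from finitely supported distributions\<close>

text \<open>The last sample is split off by Fubini and its integral is a finite sum over
  \<open>A\<close>. The sigma-algebra is that of \<open>M\<close> and not the discrete one, so
  measurability has to be carried over to each slice.\<close>

lemma nn_integral_PiM_finite_support:
  fixes w :: "'b \<Rightarrow> real" and c :: "'b \<Rightarrow> 'a" and M :: "'a measure"
  assumes A: "finite A" and w: "\<And>a. a \<in> A \<Longrightarrow> 0 \<le> w a" "sum w A = 1" and c: "c \<in> A \<rightarrow> space M"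
    and D: "D = distr (point_measure A w) M c"
    and g: "\<And>x. 0 \<le> g x" and meas: "(\<lambda>x. ennreal (g x)) \<in> borel_measurable (PiM {..<q} (\<lambda>_. D))"
  shows "(\<integral>\<^sup>+x. ennreal (g x) \<partial>PiM {..<q} (\<lambda>_. D)) = ennreal (wsum A w q (\<lambda>x. g (\<lambda>i\<in>{..<q}. c (x i))))"
  using g meas
proof (induction q arbitrary: g)
  case 0
  then show ?case by (simp add: wsum_0 PiM_empty nn_integral_count_space_finite)
next
  case (Suc q)
  have c_meas: "c \<in> measurable (point_measure A w) M"
    using c by (simp add: measurable_point_measure_eq1)
  interpret P: prob_space "point_measure A (\<lambda>a. ennreal (w a))"
    using A w by (intro prob_space_point_measure) auto
  interpret D: prob_space D
    unfolding D by (rule P.prob_space_distr[OF c_meas])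
  interpret product_sigma_finite "\<lambda>_. D"
    by standard
  have space_D: "c a \<in> space D" if "a \<in> A" for a
    using c that by (auto simp: D)
  have upd_meas: "(\<lambda>x. ennreal (g (x(q := c a)))) \<in> borel_measurable (PiM {..<q} (\<lambda>_. D))" if "a \<in> A" for a
  proof -
    have "(\<lambda>x. x(q := c a)) \<in> measurable (PiM {..<q} (\<lambda>_. D)) (PiM {..<Suc q} (\<lambda>_. D))"
      unfolding lessThan_Suc using space_D[OF that] by (intro measurable_fun_upd[where J = "{..<q}"]) auto
    from measurable_compose[OF this Suc.prems(2)] show ?thesis .
  qed
  have inner: "(\<integral>\<^sup>+y. ennreal (g (x(q := y))) \<partial>D) = (\<Sum>a\<in>A. ennreal (w a) * ennreal (g (x(q := c a))))"
    if "x \<in> space (PiM {..<q} (\<lambda>_. D))" for x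
  proof -
    have "(\<lambda>y. x(q := y)) \<in> measurable D (PiM {..<Suc q} (\<lambda>_. D))"
      unfolding lessThan_Suc using that by (intro measurable_fun_upd[where J = "{..<q}"]) auto
    from measurable_compose[OF this Suc.prems(2)]
    have "(\<lambda>y. ennreal (g (x(q := y)))) \<in> borel_measurable D" .
    then show ?thesis
      unfolding D by (subst nn_integral_distr[OF c_meas]) (simp_all add: nn_integral_point_measure_finite[OF A])
  qed
  have "(\<integral>\<^sup>+x. ennreal (g x) \<partial>PiM {..<Suc q} (\<lambda>_. D))
      = (\<integral>\<^sup>+x. (\<integral>\<^sup>+y. ennreal (g (x(q := y))) \<partial>D) \<partial>PiM {..<q} (\<lambda>_. D))"
    unfolding lessThan_Suc using Suc.prems(2) by (intro product_nn_integral_insert) (auto simp: lessThan_Suc)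
  also have "\<dots> = (\<integral>\<^sup>+x. (\<Sum>a\<in>A. ennreal (w a) * ennreal (g (x(q := c a)))) \<partial>PiM {..<q} (\<lambda>_. D))"
    by (intro nn_integral_cong inner)
  also have "\<dots> = (\<Sum>a\<in>A. ennreal (w a) * (\<integral>\<^sup>+x. ennreal (g (x(q := c a))) \<partial>PiM {..<q} (\<lambda>_. D)))"
    using upd_meas by (subst nn_integral_sum) (auto simp: nn_integral_cmult intro!: sum.cong)
  also have "\<dots> = (\<Sum>a\<in>A. ennreal (w a * wsum A w q (\<lambda>x. g ((\<lambda>i\<in>{..<q}. c (x i))(q := c a)))))"
  proof (intro sum.cong refl)
    fix a assume a: "a \<in> A"
    have "(\<integral>\<^sup>+x. ennreal (g (x(q := c a))) \<partial>PiM {..<q} (\<lambda>_. D))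
        = ennreal (wsum A w q (\<lambda>x. g ((\<lambda>i\<in>{..<q}. c (x i))(q := c a))))"
      by (rule Suc.IH[OF Suc.prems(1) upd_meas[OF a]])
    then show "ennreal (w a) * (\<integral>\<^sup>+x. ennreal (g (x(q := c a))) \<partial>PiM {..<q} (\<lambda>_. D))
        = ennreal (w a * wsum A w q (\<lambda>x. g ((\<lambda>i\<in>{..<q}. c (x i))(q := c a))))"
      by (simp only: ennreal_mult'[OF w(1)[OF a]])
  qed
  also have "\<dots> = ennreal (\<Sum>a\<in>A. w a * wsum A w q (\<lambda>x. g ((\<lambda>i\<in>{..<q}. c (x i))(q := c a))))"
    using w(1) Suc.prems(1) by (intro sum_ennreal mult_nonneg_nonneg wsum_nonneg) auto
  also have "(\<Sum>a\<in>A. w a * wsum A w q (\<lambda>x. g ((\<lambda>i\<in>{..<q}. c (x i))(q := c a))))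
      = wsum A w (Suc q) (\<lambda>x. g (\<lambda>i\<in>{..<Suc q}. c (x i)))"
  proof -
    have "(\<lambda>i\<in>{..<q}. c (x i))(q := c a) = (\<lambda>i\<in>{..<Suc q}. c ((x(q := a)) i))" for x a
      by (auto simp: fun_eq_iff restrict_def)
    then show ?thesis by (simp only: wsum_Suc[OF A])
  qed
  finally show ?case .
qed

text \<open>Integrating out the seed first leaves, for each tuple of sample points, the measure of a
  section of \<open>E\<close>; this function of the tuple is then averaged over the samples.\<close>

lemma measure_finite_support_samples:
  fixes w :: "'b \<Rightarrow> real" and c :: "'b \<Rightarrow> 'a" and M :: "'a measure"
  assumes A: "finite A" and w: "\<And>a. a \<in> A \<Longrightarrow> 0 \<le> w a" "sum w A = 1" and c: "c \<in> A \<rightarrow> space M"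
    and D: "D = distr (point_measure A w) M c"
    and R: "prob_space R" and E: "E \<in> sets (R \<Otimes>\<^sub>M PiM {..<q} (\<lambda>_. D))"
  shows "measure (R \<Otimes>\<^sub>M PiM {..<q} (\<lambda>_. D)) E
    = wsum A w q (\<lambda>x. measure R {r. (r, \<lambda>i\<in>{..<q}. c (x i)) \<in> E})"
proof -
  have c_meas: "c \<in> measurable (point_measure A w) M"
    using c by (simp add: measurable_point_measure_eq1)
  interpret P: prob_space "point_measure A (\<lambda>a. ennreal (w a))"
    using A w by (intro prob_space_point_measure) auto
  interpret D: prob_space D
    unfolding D by (rule P.prob_space_distr[OF c_meas])
  interpret S: prob_space "PiM {..<q} (\<lambda>_. D)"
    by (intro prob_space_PiM) (rule D.prob_space_axioms)
  interpret R: prob_space R by (rule R)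
  interpret pair_sigma_finite R "PiM {..<q} (\<lambda>_. D)" ..
  have eq: "emeasure R ((\<lambda>r. (r, y)) -` E) = ennreal (measure R {r. (r, y) \<in> E})" for y
    by (simp add: R.emeasure_eq_measure vimage_def)
  have "emeasure (R \<Otimes>\<^sub>M PiM {..<q} (\<lambda>_. D)) E
      = (\<integral>\<^sup>+y. ennreal (measure R {r. (r, y) \<in> E}) \<partial>PiM {..<q} (\<lambda>_. D))"
    unfolding emeasure_pair_measure_alt2[OF E] eq ..
  also have "\<dots> = ennreal (wsum A w q (\<lambda>x. measure R {r. (r, \<lambda>i\<in>{..<q}. c (x i)) \<in> E}))"
    using measurable_emeasure_Pair2[OF E]
    by (intro nn_integral_PiM_finite_support[OF A w c D]) (simp_all add: eq)
  finally show ?thesis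
    by (intro measure_eq_emeasure_eq_ennreal wsum_nonneg w(1)) auto
qed

section \<open>Distances under finitely supported distributions\<close>

lemma measure_finite_support:
  fixes w :: "'b \<Rightarrow> real"
  assumes A: "finite A" and w: "\<And>a. a \<in> A \<Longrightarrow> 0 \<le> w a" and c: "c \<in> A \<rightarrow> space M"
    and X: "X \<in> sets M"
  shows "measure (distr (point_measure A w) M c) X = (\<Sum>a\<in>A. w a * of_bool (c a \<in> X))"
proof -
  have c_meas: "c \<in> measurable (point_measure A w) M"
    using c by (simp add: measurable_point_measure_eq1)
  have "measure (distr (point_measure A w) M c) X = measure (point_measure A (\<lambda>a. ennreal (w a))) (c -` X \<inter> A)"
    using measure_distr[OF c_meas X] by (simp add: space_point_measure)
  also have "\<dots> = (\<Sum>a\<in>c -` X \<inter> A. w a)"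
    using A w by (subst measure_point_measure_finite_if) auto
  also have "\<dots> = (\<Sum>a\<in>A. w a * of_bool (c a \<in> X))"
    using A by (intro sum.mono_neutral_cong_left) auto
  finally show ?thesis .
qed

lemma fun_dist_finite_support:
  fixes w :: "'b \<Rightarrow> real"
  assumes "finite A" "\<And>a. a \<in> A \<Longrightarrow> 0 \<le> w a" "c \<in> A \<rightarrow> space M"
    and f: "f \<in> measurable M (count_space UNIV)" and h: "h \<in> measurable M (count_space UNIV)"
  shows "fun_dist (distr (point_measure A w) M c) f h = (\<Sum>a\<in>A. w a * of_bool (f (c a) \<noteq> h (c a)))"
proof -
  have X: "{x \<in> space M. f x \<noteq> h x} \<in> sets M"
    using f h by measurable
  have "fun_dist (distr (point_measure A w) M c) f h = (\<Sum>a\<in>A. w a * of_bool (c a \<in> {x \<in> space M. f x \<noteq> h x}))"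
    unfolding fun_dist_def space_distr by (rule measure_finite_support[OF assms(1) _ assms(3) X]) (rule assms(2))
  also have "\<dots> = (\<Sum>a\<in>A. w a * of_bool (f (c a) \<noteq> h (c a)))"
    using assms(3) by (intro sum.cong) (auto simp: of_bool_def)
  finally show ?thesis .
qed

section \<open>Indistinguishability of sparse and dense weights\<close>

text \<open>
  The index \<open>N\<close> is the extra point that receives the mass left over by the sites.
\<close>

definition site_weights :: "nat \<Rightarrow> real \<Rightarrow> (nat \<Rightarrow> real) \<Rightarrow> nat \<Rightarrow> real" where
  "site_weights N s U t = (if t < N then U t / s else if t = N then 1 - (\<Sum>i<N. U i) / s else 0)"

lemma sum_site_weights: "s > 0 \<Longrightarrow> sum (site_weights N s U) {..N} = 1"
  by (simp add: site_weights_def lessThan_Suc_atMost[symmetric] sum_divide_distrib)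

lemma site_weights_nonneg:
  assumes "s > 0" "\<And>i. i < N \<Longrightarrow> 0 \<le> U i" "(\<Sum>i<N. U i) \<le> s"
  shows "0 \<le> site_weights N s U t"
  using assms by (simp add: site_weights_def divide_le_eq_1)

lemma sum_fun_upd:
  fixes U :: "nat \<Rightarrow> 'b::ab_group_add"
  assumes "i < N"
  shows "(\<Sum>j<N. (U(i := t)) j) = t + (\<Sum>j\<in>{..<N} - {i}. U j)"
proof -
  have "(\<Sum>j<N. (U(i := t)) j) = (U(i := t)) i + (\<Sum>j\<in>{..<N} - {i}. (U(i := t)) j)"
    using assms by (subst sum.remove[of _ i]) auto
  also have "(\<Sum>j\<in>{..<N} - {i}. (U(i := t)) j) = (\<Sum>j\<in>{..<N} - {i}. U j)"
    by (intro sum.cong) auto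
  finally show ?thesis by simp
qed

text \<open>Mass given to site \<open>i\<close> is taken from the extra point \<open>N\<close>,
  which is the transfer treated in \<open>wsum_shift_polynomial\<close>.\<close>

lemma site_weights_upd:
  assumes "i < N"
  shows "site_weights N s (U(i := t)) =
    (\<lambda>a. site_weights N s (U(i := 0)) a + t / s * (of_bool (a = i) - of_bool (a = N)))"
  using assms by (intro ext) (simp only: site_weights_def sum_fun_upd[OF assms], auto simp: diff_divide_distrib add_divide_distrib)

text \<open>A Chernoff argument: for \<open>r > L\<close> the factor
  \<open>exp (2 * (r - L))\<close> is at least 1; inserting it and summing over all \<open>r\<close>
  gives \<open>exp (- 2 * L) * (1 + exp 2 * z) ^ q\<close>, and the last power is at most
  \<open>exp L\<close> by assumption.\<close>

lemma binomial_tail_le: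
  fixes z :: real
  assumes "0 \<le> z" "exp 2 * z * real q \<le> real L"
  shows "(\<Sum>r\<in>{..q} - {..L}. real (q choose r) * z ^ r) \<le> exp (- real L)"
proof -
  have "(\<Sum>r\<in>{..q} - {..L}. real (q choose r) * z ^ r) \<le> (\<Sum>r\<le>q. exp (- 2 * real L) * (real (q choose r) * (exp 2 * z) ^ r))"
  proof (rule sum_mono_subset)
    fix r assume r: "r \<in> {..q} - {..L}"
    have "1 \<le> exp (- 2 * real L + 2 * real r)" using r by simp
    also have "\<dots> = exp (- 2 * real L) * exp 2 ^ r"
      unfolding exp_add by (simp add: exp_of_nat_mult[symmetric] mult.commute)
    finally have "real (q choose r) * z ^ r * 1 \<le> real (q choose r) * z ^ r * (exp (- 2 * real L) * exp 2 ^ r)"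
      using assms by (intro mult_left_mono) auto
    then show "real (q choose r) * z ^ r \<le> exp (- 2 * real L) * (real (q choose r) * (exp 2 * z) ^ r)"
      by (simp add: power_mult_distrib mult_ac)
  qed (use assms in auto)
  also have "\<dots> = exp (- 2 * real L) * (exp 2 * z + 1) ^ q"
    by (simp add: binomial_ring sum_distrib_left)
  also have "\<dots> \<le> exp (- 2 * real L) * exp (exp 2 * z) ^ q"
    using assms exp_ge_add_one_self[of "exp 2 * z"] by (intro mult_left_mono power_mono) (auto simp: add.commute)
  also have "\<dots> = exp (- 2 * real L + exp 2 * z * real q)"
    unfolding exp_add by (simp add: exp_of_nat_mult[symmetric] mult_ac)
  also have "\<dots> \<le> exp (- real L)" using assms by simp
  finally show ?thesis .
qed

text \<open>The acceptance probability is a polynomial in \<open>t / s\<close>. Its terms up to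
  degree \<open>L\<close> cancel because the moments match, and the others form a binomial tail with
  \<open>z = 2 * \<Lambda> / s\<close>. The factor 2 is the total mass of \<alpha> and \<beta>
  together.\<close>

lemma acceptance_moment_bound:
  assumes "i < N" "0 < s" "0 \<le> \<Lambda>" and U: "\<And>j. j < N \<Longrightarrow> 0 \<le> U j" and sum: "(\<Sum>j\<in>{..<N} - {i}. U j) \<le> s"
    and F: "\<And>x. 0 \<le> F x \<and> F x \<le> (1::real)"
    and T: "finite T" "\<And>t. t \<in> T \<Longrightarrow> 0 \<le> t \<and> t \<le> \<Lambda>"
    and \<alpha>: "\<And>t. t \<in> T \<Longrightarrow> 0 \<le> \<alpha> t" "sum \<alpha> T = 1" and \<beta>: "\<And>t. t \<in> T \<Longrightarrow> 0 \<le> \<beta> t" "sum \<beta> T = 1"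
    and match: "\<And>r. r \<le> L \<Longrightarrow> (\<Sum>t\<in>T. (\<alpha> t - \<beta> t) * t ^ r) = 0"
    and small: "exp 2 * (2 * \<Lambda> / s) * real q \<le> real L"
  shows "\<bar>\<Sum>t\<in>T. (\<alpha> t - \<beta> t) * wsum {..N} (site_weights N s (U(i := t))) q F\<bar> \<le> 2 * exp (- real L)"
proof -
  let ?w = "site_weights N s (U(i := 0))"
  have sum0: "(\<Sum>j<N. (U(i := 0)) j) \<le> s" using sum sum_fun_upd[OF assms(1), of U 0] by simp
  have nonneg: "0 \<le> ?w a" for a
    by (rule site_weights_nonneg[OF assms(2) _ sum0]) (use U in auto)
  obtain c where c: "\<And>r. \<bar>c r\<bar> \<le> real (q choose r) * 2 ^ r"
    and eq: "\<And>p. wsum {..N} (\<lambda>a. ?w a + p * (of_bool (a = i) - of_bool (a = N))) q F = (\<Sum>r\<le>q. c r * p ^ r)"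
    using wsum_shift_polynomial[of "{..N}" ?w i N q F] nonneg sum_site_weights[OF assms(2), of N "U(i := 0)"] assms(1) F
    by (auto simp: abs_le_iff)
  have "(\<Sum>t\<in>T. (\<alpha> t - \<beta> t) * wsum {..N} (site_weights N s (U(i := t))) q F)
      = (\<Sum>t\<in>T. (\<alpha> t - \<beta> t) * (\<Sum>r\<le>q. c r * (t / s) ^ r))"
    by (intro sum.cong refl arg_cong2[where f = "(*)"]) (subst site_weights_upd[OF assms(1)], rule eq)
  also have "\<dots> = (\<Sum>r\<le>q. c r / s ^ r * (\<Sum>t\<in>T. (\<alpha> t - \<beta> t) * t ^ r))"
    unfolding sum_distrib_left by (subst sum.swap) (simp add: power_divide mult_ac)
  also have "\<dots> = (\<Sum>r\<in>{..q} - {..L}. c r / s ^ r * (\<Sum>t\<in>T. (\<alpha> t - \<beta> t) * t ^ r))"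
    by (intro sum.mono_neutral_right) (auto simp: match)
  finally have "\<bar>\<Sum>t\<in>T. (\<alpha> t - \<beta> t) * wsum {..N} (site_weights N s (U(i := t))) q F\<bar>
      \<le> (\<Sum>r\<in>{..q} - {..L}. \<bar>c r / s ^ r * (\<Sum>t\<in>T. (\<alpha> t - \<beta> t) * t ^ r)\<bar>)"
    by (simp only: sum_abs)
  also have "\<dots> \<le> (\<Sum>r\<in>{..q} - {..L}. 2 * (real (q choose r) * (2 * \<Lambda> / s) ^ r))"
  proof (rule sum_mono)
    fix r
    have "\<bar>\<Sum>t\<in>T. (\<alpha> t - \<beta> t) * t ^ r\<bar> \<le> (\<Sum>t\<in>T. (\<alpha> t + \<beta> t) * \<Lambda> ^ r)"
    proof (rule order_trans[OF sum_abs sum_mono])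
      fix t assume t: "t \<in> T"
      have "\<bar>\<alpha> t - \<beta> t\<bar> \<le> \<alpha> t + \<beta> t" using \<alpha>(1)[OF t] \<beta>(1)[OF t] by auto
      moreover have "\<bar>t ^ r\<bar> \<le> \<Lambda> ^ r" using T(2)[OF t] by (simp add: power_mono power_abs)
      ultimately show "\<bar>(\<alpha> t - \<beta> t) * t ^ r\<bar> \<le> (\<alpha> t + \<beta> t) * \<Lambda> ^ r"
        unfolding abs_mult by (intro mult_mono) auto
    qed
    also have "\<dots> = 2 * \<Lambda> ^ r"
      using \<alpha>(2) \<beta>(2) by (simp add: sum_distrib_right[symmetric] sum.distrib)
    finally have "\<bar>c r\<bar> / s ^ r * \<bar>\<Sum>t\<in>T. (\<alpha> t - \<beta> t) * t ^ r\<bar> \<le> (real (q choose r) * 2 ^ r) / s ^ r * (2 * \<Lambda> ^ r)"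
      using assms(2,3) by (intro mult_mono divide_right_mono c) auto
    also have "\<dots> = 2 * (real (q choose r) * (2 * \<Lambda> / s) ^ r)"
      by (simp add: power_divide power_mult_distrib)
    finally show "\<bar>c r / s ^ r * (\<Sum>t\<in>T. (\<alpha> t - \<beta> t) * t ^ r)\<bar> \<le> 2 * (real (q choose r) * (2 * \<Lambda> / s) ^ r)"
      using assms(2) by (simp add: abs_mult abs_divide)
  qed
  also have "\<dots> = 2 * (\<Sum>r\<in>{..q} - {..L}. real (q choose r) * (2 * \<Lambda> / s) ^ r)"
    by (simp add: sum_distrib_left)
  also have "\<dots> \<le> 2 * exp (- real L)"
    using assms(2,3) by (intro mult_left_mono binomial_tail_le small) auto
  finally show ?thesis .
qed

text \<open>On the unit interval \<open>exp x \<le> 1 + 2 * x\<close>, so the mean alone controls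
  this exponential moment.\<close>

lemma exp_mean_le:
  fixes T :: "real set" and \<alpha> :: "real \<Rightarrow> real"
  assumes "finite T" "\<And>t. t \<in> T \<Longrightarrow> 0 \<le> t \<and> t \<le> \<Lambda>" "0 < \<Lambda>"
    and \<alpha>: "\<And>t. t \<in> T \<Longrightarrow> 0 \<le> \<alpha> t" "sum \<alpha> T = 1" and mean: "(\<Sum>t\<in>T. \<alpha> t * t) \<le> \<mu>"
  shows "(\<Sum>t\<in>T. \<alpha> t * exp (t / \<Lambda>)) \<le> exp (2 * \<mu> / \<Lambda>)"
proof -
  have "(\<Sum>t\<in>T. \<alpha> t * exp (t / \<Lambda>)) \<le> (\<Sum>t\<in>T. \<alpha> t + 2 / \<Lambda> * (\<alpha> t * t))"
  proof (rule sum_mono)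
    fix t assume t: "t \<in> T"
    have "0 \<le> t / \<Lambda>" "t / \<Lambda> \<le> 1" using assms(2)[OF t] assms(3) by auto
    moreover have "exp x \<le> 1 + 2 * x" if "0 \<le> x" "x \<le> 1" for x :: real
    proof -
      have "x\<^sup>2 \<le> x" using that by (simp add: power2_eq_square mult_left_le)
      then show ?thesis using exp_bound[OF that] by linarith
    qed
    ultimately have "\<alpha> t * exp (t / \<Lambda>) \<le> \<alpha> t * (1 + 2 * (t / \<Lambda>))"
      using \<alpha>(1)[OF t] by (intro mult_left_mono) blast+
    then show "\<alpha> t * exp (t / \<Lambda>) \<le> \<alpha> t + 2 / \<Lambda> * (\<alpha> t * t)"
      by (simp add: algebra_simps)
  qed
  also have "\<dots> = 1 + 2 / \<Lambda> * (\<Sum>t\<in>T. \<alpha> t * t)"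
    by (simp add: sum.distrib \<alpha> sum_distrib_left)
  also have "\<dots> \<le> 1 + 2 / \<Lambda> * \<mu>" using mean assms(3) by (intro add_left_mono mult_left_mono) auto
  also have "\<dots> \<le> exp (2 * \<mu> / \<Lambda>)" using exp_ge_add_one_self[of "2 * \<mu> / \<Lambda>"] by simp
  finally show ?thesis .
qed

text \<open>
  The constants are those of the laws with \<open>M = 2400\<close>: their mean is at most \<open>6\<close>, so the \<open>U\<^sub>i\<close> sum to more than
  \<open>s = 120N\<close> with probability at most \<open>1/20\<close>, and the factor \<open>108\<close> is \<open>120 - 2 \<cdot> 6\<close>.
\<close>

lemma sparse_dense_indistinguishable:
  fixes F :: "(nat \<Rightarrow> nat) \<Rightarrow> real"
  assumes F: "\<And>x. 0 \<le> F x \<and> F x \<le> 1"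
    and "1 \<le> L" "1 \<le> N" and \<Lambda>: "\<Lambda> = 9600 * (real L)\<^sup>2" and s: "s = 120 * real N"
    and sparse: "\<And>U. (\<And>i. i < N \<Longrightarrow> 0 \<le> U i) \<Longrightarrow> (\<Sum>i<N. U i) \<le> s \<Longrightarrow>
      real (card {i. i < N \<and> U i \<noteq> 0}) \<le> real N / 24 \<Longrightarrow> 2 / 3 \<le> wsum {..N} (site_weights N s U) q F"
    and dense: "\<And>U. (\<And>i. i < N \<Longrightarrow> 0 \<le> U i) \<Longrightarrow> (\<Sum>i<N. U i) \<le> s \<Longrightarrow>
      real (card {i. i < N \<and> U i \<noteq> 1}) \<le> real N / 8 \<Longrightarrow> wsum {..N} (site_weights N s U) q F \<le> 1 / 3"
    and moments: "real N * (2 * exp (- real L)) \<le> 1 / 20"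
    and overflow: "real N * exp (1 - 108 * real N / \<Lambda>) \<le> 1 / 20"
    and samples: "exp 2 * (2 * \<Lambda> / s) * real q \<le> real L"
  shows False
proof -
  have \<Lambda>0: "0 < \<Lambda>" using \<open>1 \<le> L\<close> by (simp add: \<Lambda>)
  have s0: "0 < s" using \<open>1 \<le> N\<close> by (simp add: s)
  have \<Lambda>_eq: "4 * 2400 * (real L)\<^sup>2 = \<Lambda>" by (simp add: \<Lambda>)
  obtain T \<alpha> \<beta> where T: "finite T" "0 \<in> T" "1 \<in> T" "\<And>t. t \<in> T \<Longrightarrow> 0 \<le> t \<and> t \<le> \<Lambda>"
    and \<alpha>: "\<And>t. 0 \<le> \<alpha> t" "sum \<alpha> T = 1" and \<beta>: "\<And>t. 0 \<le> \<beta> t" "sum \<beta> T = 1"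
    and match: "\<And>r. r \<le> L \<Longrightarrow> (\<Sum>t\<in>T. (\<alpha> t - \<beta> t) * t ^ r) = 0"
    and off: "sum \<alpha> (T - {0}) \<le> 5 / 2400" "sum \<beta> (T - {1}) \<le> 1 / 2400"
    and mean: "(\<Sum>t\<in>T. \<alpha> t * t) \<le> 6" "(\<Sum>t\<in>T. \<beta> t * t) \<le> 6"
    by (rule matching_moments_exist[of 2400 L, unfolded \<Lambda>_eq, OF _ \<open>1 \<le> L\<close> that]; (assumption | simp))
  txt \<open>Beyond \<open>s\<close> the extra point would have negative mass, and the acceptance is cut off.\<close>
  define \<Phi> where "\<Phi> U = (if (\<Sum>i<N. U i) \<le> s then wsum {..N} (site_weights N s U) q F else 0)" for U
  have PiE_nonneg: "0 \<le> U i" if "U \<in> PiE {..<N} (\<lambda>_. T)" "i < N" for U i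
    using that T(4) by (auto simp: PiE_def Pi_def)
  have \<Phi>01: "0 \<le> \<Phi> U \<and> \<Phi> U \<le> 1" if "\<And>i. i < N \<Longrightarrow> 0 \<le> U i" for U
  proof (cases "(\<Sum>i<N. U i) \<le> s")
    case True
    have w: "0 \<le> site_weights N s U a" for a
      using site_weights_nonneg[OF s0 _ True] that by blast
    have "wsum {..N} (site_weights N s U) q (\<lambda>_. 0) \<le> wsum {..N} (site_weights N s U) q F"
      "wsum {..N} (site_weights N s U) q F \<le> wsum {..N} (site_weights N s U) q (\<lambda>_. 1)"
      using F w by (auto intro!: wsum_mono)
    then show ?thesis
      unfolding \<Phi>_def wsum_const[OF finite_atMost sum_site_weights[OF s0]] using True by simp
  qed (simp add: \<Phi>_def)
  have site: "\<bar>\<Sum>t\<in>T. (\<alpha> t - \<beta> t) * \<Phi> (U(i := t))\<bar>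
      \<le> 2 * exp (- real L) + exp (1 - s / \<Lambda>) * (\<Prod>j\<in>{..<N} - {i}. exp (U j / \<Lambda>))"
    if i: "i < N" and U: "U \<in> PiE {..<N} (\<lambda>_. T)" for i U
  proof -
    let ?s' = "\<Sum>j\<in>{..<N} - {i}. U j"
    have prod: "exp (1 - s / \<Lambda>) * (\<Prod>j\<in>{..<N} - {i}. exp (U j / \<Lambda>)) = exp ((?s' - (s - \<Lambda>)) / \<Lambda>)"
      using \<Lambda>0 by (simp add: exp_sum[symmetric] exp_add[symmetric] sum_divide_distrib[symmetric] field_simps)
    show ?thesis
    \<comment> \<open>Either no value up to \<Lambda> at site \<open>i\<close> brings the total
      above \<open>s\<close>, and the moment bound applies, or the exponential term is at least 1
      and dominates the trivial bound.\<close>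
    proof (cases "?s' \<le> s - \<Lambda>")
      case True
      have "\<Phi> (U(i := t)) = wsum {..N} (site_weights N s (U(i := t))) q F" if "t \<in> T" for t
        using True T(4)[OF that] sum_fun_upd[OF i, of U t] by (simp only: \<Phi>_def) simp
      then have "(\<Sum>t\<in>T. (\<alpha> t - \<beta> t) * \<Phi> (U(i := t)))
          = (\<Sum>t\<in>T. (\<alpha> t - \<beta> t) * wsum {..N} (site_weights N s (U(i := t))) q F)"
        by (intro sum.cong) auto
      moreover have "?s' \<le> s" using True \<Lambda>0 by linarith
      then have "\<bar>\<Sum>t\<in>T. (\<alpha> t - \<beta> t) * wsum {..N} (site_weights N s (U(i := t))) q F\<bar> \<le> 2 * exp (- real L)"
        using \<Lambda>0 \<alpha> \<beta> T match samples F PiE_nonneg[OF U]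
        by (intro acceptance_moment_bound[OF i s0, where \<Lambda> = \<Lambda>]) auto
      moreover have "0 \<le> exp ((?s' - (s - \<Lambda>)) / \<Lambda>)" by simp
      ultimately show ?thesis unfolding prod by linarith
    next
      case False
      have bnd: "0 \<le> \<Phi> (U(i := t)) \<and> \<Phi> (U(i := t)) \<le> 1" if "t \<in> T" for t
        by (rule \<Phi>01) (use that T(4) PiE_nonneg[OF U] in auto)
      have avg: "0 \<le> (\<Sum>t\<in>T. p t * \<Phi> (U(i := t))) \<and> (\<Sum>t\<in>T. p t * \<Phi> (U(i := t))) \<le> 1"
        if "\<And>t. 0 \<le> p t" "sum p T = 1" for p :: "real \<Rightarrow> real"
      proof -
        have "(\<Sum>t\<in>T. p t * \<Phi> (U(i := t))) \<le> (\<Sum>t\<in>T. p t * 1)"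
          using bnd that by (intro sum_mono mult_left_mono) auto
        then show ?thesis using bnd that by (auto intro!: sum_nonneg)
      qed
      have "\<bar>\<Sum>t\<in>T. (\<alpha> t - \<beta> t) * \<Phi> (U(i := t))\<bar> \<le> 1"
        using avg[OF \<alpha>(1) \<alpha>(2)] avg[OF \<beta>(1) \<beta>(2)]
        unfolding left_diff_distrib sum_subtractf by linarith
      moreover have "1 \<le> exp ((?s' - (s - \<Lambda>)) / \<Lambda>)" using False \<Lambda>0 by simp
      moreover have "0 \<le> 2 * exp (- real L)" by simp
      ultimately show ?thesis unfolding prod by linarith
    qed
  qed
  have \<rho>: "(\<Sum>t\<in>T. \<alpha> t * exp (t / \<Lambda>)) \<le> exp (12 / \<Lambda>)" "(\<Sum>t\<in>T. \<beta> t * exp (t / \<Lambda>)) \<le> exp (12 / \<Lambda>)"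
    using exp_mean_le[of T \<Lambda> \<alpha> 6] exp_mean_le[of T \<Lambda> \<beta> 6] T \<Lambda>0 \<alpha> \<beta> mean by auto
  have "\<bar>wsum T \<alpha> N \<Phi> - wsum T \<beta> N \<Phi>\<bar>
      \<le> real N * (2 * exp (- real L) + exp (1 - s / \<Lambda>) * exp (12 / \<Lambda>) ^ (N - 1))"
    by (rule wsum_hybrid[OF T(1) \<alpha>(1) \<alpha>(2) \<beta>(1) \<beta>(2), where \<phi> = "\<lambda>t. exp (t / \<Lambda>)"])
      (use \<rho> site in auto)
  also have "\<dots> \<le> real N * (2 * exp (- real L)) + real N * exp (1 - 108 * real N / \<Lambda>)"
  proof -
    have "exp (1 - s / \<Lambda>) * exp (12 / \<Lambda>) ^ (N - 1) \<le> exp (1 - s / \<Lambda>) * exp (12 / \<Lambda>) ^ N"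
      using \<Lambda>0 by (intro mult_left_mono power_increasing) auto
    also have "\<dots> = exp (1 - 108 * real N / \<Lambda>)"
      using \<Lambda>0 by (simp add: s exp_of_nat_mult[symmetric] exp_add[symmetric] field_simps)
    finally show ?thesis by (simp add: distrib_left mult_left_mono)
  qed
  also have "\<dots> \<le> 1 / 10" using moments overflow by linarith
  finally have close: "wsum T \<alpha> N \<Phi> - wsum T \<beta> N \<Phi> \<le> 1 / 10" by linarith
  have card_eq: "(\<Sum>i<N. of_bool (U i \<noteq> u)) = real (card {i. i < N \<and> U i \<noteq> u})" for U :: "nat \<Rightarrow> real" and u
    by (simp add: of_bool_def sum.If_cases Collect_conj_eq Int_commute lessThan_def)
  have off_sum: "(\<Sum>t\<in>T. p t * of_bool (t \<noteq> u)) = sum p (T - {u})" for p :: "real \<Rightarrow> real" and u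
    using T(1) by (intro sum.mono_neutral_cong_right) auto
  \<comment> \<open>A union bound over overflow and too many charged sites. By Markov's inequality
    their probabilities are at most \<open>6 * N / (120 * N)\<close> and
    \<open>N * (5 / 2400) / (N / 24)\<close>, both equal to 1/20.\<close>
  have "wsum T \<alpha> N (\<lambda>U. 2 / 3 - of_bool ((\<Sum>i<N. U i) > s) - of_bool ((\<Sum>i<N. of_bool (U i \<noteq> 0)) > real N / 24)) \<le> wsum T \<alpha> N \<Phi>"
  proof (rule wsum_mono)
    fix U assume U: "U \<in> PiE {..<N} (\<lambda>_. T)"
    show "2 / 3 - of_bool ((\<Sum>i<N. U i) > s) - of_bool ((\<Sum>i<N. of_bool (U i \<noteq> 0)) > real N / 24) \<le> \<Phi> U"
      using sparse[of U] PiE_nonneg[OF U] \<Phi>01[of U] unfolding card_eq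
      by (auto simp: \<Phi>_def not_le of_bool_def)
  qed (simp add: \<alpha> \<beta>)
  moreover have "wsum T \<alpha> N (\<lambda>U. of_bool ((\<Sum>i<N. U i) > s)) \<le> 1 / 20"
    using wsum_markov[OF T(1) \<alpha>(2) \<alpha>(1), of "\<lambda>t. t" s N] T(4) s0 mean(1) \<open>1 \<le> N\<close>
    by (auto simp: s field_simps)
  moreover have "wsum T \<alpha> N (\<lambda>U. of_bool ((\<Sum>i<N. of_bool (U i \<noteq> 0)) > real N / 24)) \<le> 1 / 20"
    using wsum_markov[OF T(1) \<alpha>(2) \<alpha>(1), of "\<lambda>t. of_bool (t \<noteq> 0)" "real N / 24" N] off(1) \<open>1 \<le> N\<close>
    unfolding off_sum by (auto simp: field_simps)
  ultimately have low: "2 / 3 - 1 / 10 \<le> wsum T \<alpha> N \<Phi>"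
    unfolding wsum_diff wsum_const[OF T(1) \<alpha>(2)] by linarith
  \<comment> \<open>Overflow costs nothing in this direction, since \<Phi> is \<open>0\<close>
    there.\<close>
  have "wsum T \<beta> N \<Phi> \<le> wsum T \<beta> N (\<lambda>U. 1 / 3 + of_bool ((\<Sum>i<N. of_bool (U i \<noteq> 1)) > real N / 8))"
  proof (rule wsum_mono)
    fix U assume U: "U \<in> PiE {..<N} (\<lambda>_. T)"
    show "\<Phi> U \<le> 1 / 3 + of_bool ((\<Sum>i<N. of_bool (U i \<noteq> 1)) > real N / 8)"
      using dense[of U] PiE_nonneg[OF U] \<Phi>01[of U] unfolding card_eq
      by (auto simp: \<Phi>_def not_le of_bool_def)
  qed (simp add: \<alpha> \<beta>)
  moreover have "wsum T \<beta> N (\<lambda>U. of_bool ((\<Sum>i<N. of_bool (U i \<noteq> 1)) > real N / 8)) \<le> 1 / 20"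
    using wsum_markov[OF T(1) \<beta>(2) \<beta>(1), of "\<lambda>t. of_bool (t \<noteq> 1)" "real N / 8" N] off(2) \<open>1 \<le> N\<close>
    unfolding off_sum by (auto simp: field_simps)
  ultimately have "wsum T \<beta> N \<Phi> \<le> 1 / 3 + 1 / 20"
    unfolding wsum_add wsum_const[OF T(1) \<beta>(2)] by linarith
  \<comment> \<open>The two bounds are 17/30 and 23/60; they differ by 11/60, more than
    1/10.\<close>
  with low close show False by linarith
qed

section \<open>The hard instances\<close>

text \<open>Only the odd sites below \<open>N\<close> are labelled false; the extra point and the
  rest of the space are true, so realising the label on the support means excluding the charged odd
  sites.\<close>

definition parity_label :: "nat \<Rightarrow> nat \<Rightarrow> (nat \<Rightarrow> real) \<Rightarrow> bool" where
  "parity_label n N x \<longleftrightarrow> (\<forall>t<N. odd t \<longrightarrow> x \<noteq> curve n t)"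

lemma parity_label_curve: "n \<ge> 1 \<Longrightarrow> parity_label n N (curve n t) \<longleftrightarrow> \<not> (t < N \<and> odd t)"
  by (auto simp: parity_label_def curve_inj)

lemma singleton_sets_Rn: "{curve n t} \<in> sets (Rn n)"
proof -
  have "PiE {..<n} (\<lambda>i. {curve n t i}) = {curve n t}"
    unfolding curve_def by (rule PiE_singleton) (rule restrict_extensional)
  moreover have "PiE {..<n} (\<lambda>i. {curve n t i}) \<in> sets (Rn n)"
    unfolding Rn_def by (rule sets_PiM_I_finite) auto
  ultimately show ?thesis by simp
qed

lemma parity_label_measurable: "parity_label n N \<in> measurable (Rn n) (count_space UNIV)"
proof -
  have "{x \<in> space (Rn n). parity_label n N x} = space (Rn n) - (\<Union>t\<in>{t. t < N \<and> odd t}. {curve n t})"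
    by (auto simp: parity_label_def)
  also have "\<dots> \<in> sets (Rn n)"
    by (intro sets.Diff sets.top sets.finite_UN singleton_sets_Rn) auto
  finally show ?thesis by (simp add: pred_def)
qed

definition site_dist :: "nat \<Rightarrow> nat \<Rightarrow> real \<Rightarrow> (nat \<Rightarrow> real) \<Rightarrow> (nat \<Rightarrow> real) measure" where
  "site_dist n N s U = distr (point_measure {..N} (\<lambda>a. ennreal (site_weights N s U a))) (Rn n) (curve n)"

lemma sets_site_dist: "sets (site_dist n N s U) = sets (Rn n)"
  by (simp add: site_dist_def)

lemma distribution_on_site_dist:
  assumes "s > 0" "\<And>i. i < N \<Longrightarrow> 0 \<le> U i" "(\<Sum>i<N. U i) \<le> s"
  shows "distribution_on (Rn n) (site_dist n N s U)"
proof -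
  interpret P: prob_space "point_measure {..N} (\<lambda>a. ennreal (site_weights N s U a))"
    using site_weights_nonneg[OF assms] sum_site_weights[OF assms(1)] by (intro prob_space_point_measure) auto
  have "curve n \<in> measurable (point_measure {..N} (\<lambda>a. ennreal (site_weights N s U a))) (Rn n)"
    by (simp add: measurable_point_measure_eq1 curve_in_space)
  then show ?thesis
    unfolding distribution_on_def sets_site_dist by (simp add: site_dist_def P.prob_space_distr)
qed

lemma halfspace_intersections_nonempty: "halfspace_intersections n k \<noteq> {}"
  using halfspace_intersection_excludes[of "{}" k n] by auto

lemma sparse_label_realised:
  assumes "n \<ge> 1" and sparse: "card {i. i < N \<and> U i \<noteq> 0} \<le> k * (n div 2)"
  shows "\<exists>h\<in>halfspace_intersections n k. \<forall>t. site_weights N s U t \<noteq> 0 \<longrightarrow>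
    h (curve n t) = parity_label n N (curve n t)"
proof -
  let ?F = "{i. i < N \<and> odd i \<and> U i \<noteq> 0}"
  have "card ?F \<le> card {i. i < N \<and> U i \<noteq> 0}" by (intro card_mono) auto
  then obtain h where h: "h \<in> halfspace_intersections n k" "\<And>t. h (curve n t) \<longleftrightarrow> t \<notin> ?F"
    using halfspace_intersection_excludes[of ?F k n] sparse by auto
  show ?thesis
    by (intro bexI[OF _ h(1)]) (auto simp: h(2) parity_label_curve[OF assms(1)] site_weights_def)
qed

lemma sum_pairs:
  fixes g :: "nat \<Rightarrow> 'b::comm_monoid_add"
  shows "(\<Sum>t<2 * p. g t) = (\<Sum>i<p. g (2 * i) + g (2 * i + 1))"
  by (induction p) (simp_all add: add.assoc)

text \<open>The sites are grouped into \<open>p\<close> pairs. A pair carrying mass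
  \<open>1 / s\<close> at both ends contributes at least \<open>1 / s\<close> unless
  \<open>h\<close> holds at its even and fails at its odd member. Each site with
  \<open>U i \<noteq> 1\<close> spoils at most one pair, and \<open>h\<close> descends on at most
  \<open>n * k\<close> pairs.\<close>

lemma dense_label_far:
  assumes "n \<ge> 1" "s > 0" and U: "\<And>i. i < 2 * p \<Longrightarrow> 0 \<le> U i" "(\<Sum>i<2 * p. U i) \<le> s"
    and h: "h \<in> halfspace_intersections n k"
  shows "(real p - real (card {i. i < 2 * p \<and> U i \<noteq> 1}) - real (n * k)) / s
    \<le> fun_dist (site_dist n (2 * p) s U) (parity_label n (2 * p)) h"
proof -
  let ?c = "curve n" and ?f = "parity_label n (2 * p)" and ?w = "site_weights (2 * p) s U"
  define g where "g t = ?w t * of_bool (?f (?c t) \<noteq> h (?c t))" for t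
  have w: "0 \<le> ?w t" for t by (rule site_weights_nonneg[OF assms(2) U])
  have g0: "0 \<le> g t" for t using w by (simp add: g_def)
  let ?B = "{i. i < p \<and> U (2 * i) = 1 \<and> U (2 * i + 1) = 1 \<and> \<not> (h (?c (2 * i)) \<and> \<not> h (?c (2 * i + 1)))}"
  let ?A = "{i. i < p \<and> h (?c (2 * i)) \<and> \<not> h (?c (2 * i + 1))}"
  let ?V = "{i. i < p \<and> (U (2 * i) \<noteq> 1 \<or> U (2 * i + 1) \<noteq> 1)}"
  have "card ?V \<le> card {i. i < 2 * p \<and> U i \<noteq> 1}"
  proof (rule card_inj_on_le)
    show "inj_on (\<lambda>i. if U (2 * i) \<noteq> 1 then 2 * i else 2 * i + 1) ?V"
      by (auto simp: inj_on_def split: if_splits)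
  qed auto
  moreover have "card ?A \<le> n * k" using card_alternations_le[OF h] by (simp add: mult.commute)
  moreover have "p \<le> card ?B + card ?V + card ?A"
  proof -
    have "p = card {..<p}" by simp
    also have "\<dots> \<le> card (?B \<union> ?V \<union> ?A)" by (intro card_mono) auto
    also have "\<dots> \<le> card ?B + card ?V + card ?A"
      by (meson add_le_mono1 card_Un_le order_trans)
    finally show ?thesis .
  qed
  ultimately have "p \<le> card ?B + card {i. i < 2 * p \<and> U i \<noteq> 1} + n * k" by linarith
  then have "real p - real (card {i. i < 2 * p \<and> U i \<noteq> 1}) - real (n * k) \<le> real (card ?B)"
    by linarith
  then have "(real p - real (card {i. i < 2 * p \<and> U i \<noteq> 1}) - real (n * k)) / s \<le> (\<Sum>i\<in>?B. 1 / s)"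
    using \<open>s > 0\<close> by (simp add: divide_right_mono)
  also have "\<dots> \<le> (\<Sum>i<p. g (2 * i) + g (2 * i + 1))"
  proof (rule sum_mono_subset)
    fix i assume i: "i \<in> ?B"
    then have "2 * i < 2 * p" "2 * i + 1 < 2 * p" by auto
    moreover from this have "?f (?c (2 * i))" "\<not> ?f (?c (2 * i + 1))"
      using assms(1) by (auto simp: parity_label_curve)
    ultimately show "1 / s \<le> g (2 * i) + g (2 * i + 1)"
      using i \<open>s > 0\<close> by (auto simp: g_def site_weights_def of_bool_def)
  qed (use g0 in auto)
  also have "\<dots> = (\<Sum>t<2 * p. g t)" by (rule sum_pairs[symmetric])
  also have "\<dots> \<le> (\<Sum>t\<le>2 * p. g t)"
    using g0 by (intro sum_mono2) auto
  also have "\<dots> = fun_dist (site_dist n (2 * p) s U) ?f h"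
    unfolding site_dist_def g_def using w curve_in_space halfspace_intersection_measurable[OF h] parity_label_measurable
    by (intro fun_dist_finite_support[symmetric]) auto
  finally show ?thesis .
qed

lemma sparse_class_dist:
  assumes "s > 0" "\<And>i. i < N \<Longrightarrow> 0 \<le> U i" "(\<Sum>i<N. U i) \<le> s"
    and h: "h \<in> halfspace_intersections n k"
    and agree: "\<And>t. site_weights N s U t \<noteq> 0 \<Longrightarrow> h (curve n t) = parity_label n N (curve n t)"
  shows "class_dist (site_dist n N s U) (parity_label n N) (halfspace_intersections n k) = 0"
proof -
  have "fun_dist (site_dist n N s U) (parity_label n N) h
      = (\<Sum>a\<in>{..N}. site_weights N s U a * of_bool (parity_label n N (curve n a) \<noteq> h (curve n a)))"
    unfolding site_dist_def
    using site_weights_nonneg[OF assms(1-3)] curve_in_space halfspace_intersection_measurable[OF h] parity_label_measurable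
    by (intro fun_dist_finite_support) auto
  also have "\<dots> = 0"
    using agree by (intro sum.neutral) auto
  finally have "fun_dist (site_dist n N s U) (parity_label n N) h = 0" .
  moreover have "0 \<le> fun_dist D f g" for D :: "(nat \<Rightarrow> real) measure" and f g
    by (simp add: fun_dist_def)
  ultimately have "class_dist (site_dist n N s U) (parity_label n N) (halfspace_intersections n k) \<le> 0"
    "0 \<le> class_dist (site_dist n N s U) (parity_label n N) (halfspace_intersections n k)"
    unfolding class_dist_def using h
    by (auto intro!: cINF_lower2[OF _ h] cINF_greatest[OF halfspace_intersections_nonempty] bdd_belowI[of _ 0])
  then show ?thesis by simp
qed

text \<open>
  The choice is \<open>L = \<lceil>3 ln (8d)\<rceil>\<close>.
\<close>

lemma parameters_exist:
  "\<exists>d0\<ge>2. \<forall>d::nat. d \<ge> d0 \<longrightarrow> (\<exists>L::nat. 1 \<le> L \<and> real L \<le> 8 * ln (real d) \<and>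
    real (8 * d) * (2 * exp (- real L)) \<le> 1 / 20 \<and>
    real (8 * d) * exp (1 - 108 * real (8 * d) / (9600 * (real L)\<^sup>2)) \<le> 1 / 20)"
proof -
  \<comment> \<open>The \<open>+ 1\<close> allows for the ceiling in \<open>L\<close>. The overflow
    estimate that follows is stated for \<open>8 * ln d\<close>, an upper bound on \<open>L\<close>,
    and passes to \<open>L\<close> by monotonicity.\<close>
  have "\<forall>\<^sub>F d::nat in sequentially. 3 * ln (8 * real d) + 1 \<le> 8 * ln (real d)"
    by real_asymp
  moreover have "\<forall>\<^sub>F d::nat in sequentially.
      8 * real d * exp (1 - 108 * (8 * real d) / (9600 * (8 * ln (real d))\<^sup>2)) \<le> 1 / 20"
    by real_asymp
  ultimately have "\<forall>\<^sub>F d::nat in sequentially. d \<ge> 2 \<and> 3 * ln (8 * real d) + 1 \<le> 8 * ln (real d) \<and>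
      8 * real d * exp (1 - 108 * (8 * real d) / (9600 * (8 * ln (real d))\<^sup>2)) \<le> 1 / 20"
    using eventually_ge_at_top[of "2::nat"] by eventually_elim auto
  then obtain d0 where d0: "\<And>d::nat. d \<ge> d0 \<Longrightarrow> d \<ge> 2 \<and> 3 * ln (8 * real d) + 1 \<le> 8 * ln (real d) \<and>
      8 * real d * exp (1 - 108 * (8 * real d) / (9600 * (8 * ln (real d))\<^sup>2)) \<le> 1 / 20"
    by (auto simp: eventually_sequentially)
  show ?thesis
  proof (rule exI[of _ d0], intro conjI allI impI)
    show "2 \<le> d0" using d0[of d0] by simp
    fix d :: nat assume d: "d0 \<le> d"
    define L where "L = nat \<lceil>3 * ln (8 * real d)\<rceil>"
    have d2: "2 \<le> d" using d0[OF d] by simp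
    then have ln_pos: "0 < ln (8 * real d)" by simp
    have L: "3 * ln (8 * real d) \<le> real L" "real L \<le> 3 * ln (8 * real d) + 1"
      unfolding L_def using ln_pos by linarith+
    have L1: "1 \<le> L" using L(1) ln_pos by linarith
    have L8: "real L \<le> 8 * ln (real d)" using L(2) d0[OF d] by linarith
    have "exp (- real L) \<le> exp (- (3 * ln (8 * real d)))" using L(1) by simp
    also have "\<dots> = 1 / (8 * real d) ^ 3"
      using d2 by (simp add: exp_minus exp_of_nat_mult[of 3, simplified] inverse_eq_divide)
    finally have "real (8 * d) * (2 * exp (- real L)) \<le> real (8 * d) * (2 * (1 / (8 * real d) ^ 3))"
      by (intro mult_left_mono) auto
    also have "\<dots> = 2 / (8 * real d)\<^sup>2"
      using d2 by (simp add: power2_eq_square power3_eq_cube)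
    also have "\<dots> \<le> 2 / 16\<^sup>2"
      using d2 by (intro divide_left_mono power_mono) auto
    finally have a: "real (8 * d) * (2 * exp (- real L)) \<le> 1 / 20" by simp
    have "(real L)\<^sup>2 \<le> (8 * ln (real d))\<^sup>2" using L8 by (intro power_mono) auto
    then have "108 * real (8 * d) / (9600 * (8 * ln (real d))\<^sup>2) \<le> 108 * real (8 * d) / (9600 * (real L)\<^sup>2)"
      using L1 d2 by (intro divide_left_mono mult_pos_pos) auto
    then have "real (8 * d) * exp (1 - 108 * real (8 * d) / (9600 * (real L)\<^sup>2))
        \<le> real (8 * d) * exp (1 - 108 * real (8 * d) / (9600 * (8 * ln (real d))\<^sup>2))"
      by (intro mult_left_mono) auto
    also have "\<dots> \<le> 1 / 20" using d0[OF d] by simp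
    finally show "\<exists>L::nat. 1 \<le> L \<and> real L \<le> 8 * ln (real d) \<and>
      real (8 * d) * (2 * exp (- real L)) \<le> 1 / 20 \<and>
      real (8 * d) * exp (1 - 108 * real (8 * d) / (9600 * (real L)\<^sup>2)) \<le> 1 / 20"
      using L1 L8 a by blast
  qed
qed

section \<open>The lower bounds\<close>

text \<open>
  What remains of either kind of tester on the hard instances, as a function of the seed and the sample
  points alone.
\<close>

definition separates ::
  "nat \<Rightarrow> nat \<Rightarrow> real \<Rightarrow> nat \<Rightarrow> real measure \<Rightarrow> (real \<Rightarrow> (nat \<Rightarrow> nat \<Rightarrow> real) \<Rightarrow> bool) \<Rightarrow> bool" where
  "separates n k \<epsilon> q R out \<longleftrightarrow> prob_space R \<and>
    (let N = 2 * (4 * (n * k)); s = 120 * real N; f = parity_label n N in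
      \<forall>U. (\<forall>i<N. 0 \<le> U i) \<and> (\<Sum>i<N. U i) \<le> s \<longrightarrow>
        (let D = site_dist n N s U; S = R \<Otimes>\<^sub>M PiM {..<q} (\<lambda>_. D) in
          ((\<exists>h\<in>halfspace_intersections n k. \<forall>t. site_weights N s U t \<noteq> 0 \<longrightarrow> h (curve n t) = f (curve n t)) \<longrightarrow>
            2 / 3 \<le> measure S {(r, xs) \<in> space S. out r xs = True}) \<and>
          (\<epsilon> \<le> class_dist D f (halfspace_intersections n k) \<longrightarrow>
            2 / 3 \<le> measure S {(r, xs) \<in> space S. out r xs = False})))"

text \<open>Of the \<open>4 * n * k\<close> pairs at most \<open>n * k\<close> are lost to irregular
  sites and \<open>n * k\<close> to alternations. The remaining \<open>2 * n * k\<close> have mass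
  \<open>1 / s\<close> with \<open>s = 960 * n * k\<close>, whence 1/480.\<close>

lemma dense_class_dist:
  assumes "n \<ge> 1" "k \<ge> 1" "\<epsilon> \<le> 1 / 480" and N: "N = 2 * (4 * (n * k))" and s: "s = 120 * real N"
    and U: "\<And>i. i < N \<Longrightarrow> 0 \<le> U i" "(\<Sum>i<N. U i) \<le> s" and dense: "card {i. i < N \<and> U i \<noteq> 1} \<le> n * k"
  shows "\<epsilon> \<le> class_dist (site_dist n N s U) (parity_label n N) (halfspace_intersections n k)"
  unfolding class_dist_def
proof (rule cINF_greatest[OF halfspace_intersections_nonempty])
  fix h assume h: "h \<in> halfspace_intersections n k"
  let ?d = "real (n * k)"
  have d: "0 < ?d" using assms(1,2) by simp
  have s_eq: "s = 960 * ?d" by (simp add: s N)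
  have "(2 * ?d) / s = 1 / 480" using d unfolding s_eq by (simp del: of_nat_mult)
  from ord_le_eq_trans[OF assms(3) this[symmetric]] have "\<epsilon> \<le> (2 * ?d) / s" .
  also have "\<dots> \<le> (real (4 * (n * k)) - real (card {i. i < N \<and> U i \<noteq> 1}) - ?d) / s"
  proof (rule divide_right_mono)
    have "real (card {i. i < N \<and> U i \<noteq> 1}) \<le> ?d" using dense by (simp only: of_nat_le_iff)
    then show "2 * ?d \<le> real (4 * (n * k)) - real (card {i. i < N \<and> U i \<noteq> 1}) - ?d" by (simp add: algebra_simps)
    show "0 \<le> s" using d by (simp add: s_eq)
  qed
  also have "\<dots> \<le> fun_dist (site_dist n N s U) (parity_label n N) h"
    unfolding N by (rule dense_label_far) (use assms(1) d s_eq U h in \<open>auto simp: N\<close>)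
  finally show "\<epsilon> \<le> fun_dist (site_dist n N s U) (parity_label n N) h" .
qed

text \<open>\<open>F\<close> is the acceptance probability over the seed for given sample sites. One
  \<open>F\<close> serves all \<open>U\<close>, because neither the labelling nor the sigma-algebra
  depends on \<open>U\<close>.\<close>

lemma separates_acceptance:
  assumes nk: "n \<ge> 1" "k \<ge> 1" and \<epsilon>: "\<epsilon> \<le> 1 / 480" and sep: "separates n k \<epsilon> q R out"
    and N: "N = 2 * (4 * (n * k))" and s: "s = 120 * real N"
  shows "\<exists>F :: (nat \<Rightarrow> nat) \<Rightarrow> real. (\<forall>x. 0 \<le> F x \<and> F x \<le> 1) \<and>
    (\<forall>U. (\<forall>i<N. 0 \<le> U i) \<and> (\<Sum>i<N. U i) \<le> s \<longrightarrow>
      (card {i. i < N \<and> U i \<noteq> 0} \<le> k * (n div 2) \<longrightarrow> 2 / 3 \<le> wsum {..N} (site_weights N s U) q F) \<and>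
      (card {i. i < N \<and> U i \<noteq> 1} \<le> n * k \<longrightarrow> wsum {..N} (site_weights N s U) q F \<le> 1 / 3))"
proof -
  let ?f = "parity_label n N" and ?H = "halfspace_intersections n k"
  let ?D = "\<lambda>U. site_dist n N s U"
  define S where "S D = R \<Otimes>\<^sub>M PiM {..<q} (\<lambda>_. D)" for D :: "(nat \<Rightarrow> real) measure"
  define E where "E = {(r, xs) \<in> space (S (Rn n)). out r xs = True}"
  have R: "prob_space R" using sep by (simp add: separates_def)
  interpret R: prob_space R by (rule R)
  have s0: "0 < s" using nk by (simp add: s N)
  have sets_S: "sets (S (?D U)) = sets (S (Rn n))" for U
    unfolding S_def by (intro sets_pair_measure_cong sets_PiM_cong refl sets_site_dist)
  have space_S: "space (S (?D U)) = space (S (Rn n))" for U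
    by (rule sets_eq_imp_space_eq[OF sets_S])
  have sparse: "2 / 3 \<le> measure (S (?D U)) E"
    if "\<And>i. i < N \<Longrightarrow> 0 \<le> U i" "(\<Sum>i<N. U i) \<le> s"
      "\<exists>h\<in>?H. \<forall>t. site_weights N s U t \<noteq> 0 \<longrightarrow> h (curve n t) = ?f (curve n t)" for U
    using sep that unfolding separates_def Let_def N[symmetric] s[symmetric] S_def[symmetric] space_S E_def[symmetric]
    by blast
  have dense: "2 / 3 \<le> measure (S (?D U)) {(r, xs) \<in> space (S (Rn n)). out r xs = False}"
    if "\<And>i. i < N \<Longrightarrow> 0 \<le> U i" "(\<Sum>i<N. U i) \<le> s" "\<epsilon> \<le> class_dist (?D U) ?f ?H" for U
    using sep that unfolding separates_def Let_def N[symmetric] s[symmetric] S_def[symmetric] space_S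
    by blast
  have E: "E \<in> sets (S (Rn n))"
  proof -
    \<comment> \<open>With \<open>U = 0\<close> all mass is at the extra point, a sparse instance. A
      set of positive \<open>measure\<close> is measurable, and the sigma-algebra is the same for
      all \<open>U\<close>.\<close>
    have "2 / 3 \<le> measure (S (?D (\<lambda>_. 0))) E"
      using s0 by (intro sparse sparse_label_realised nk(1)) auto
    then have "E \<in> sets (S (?D (\<lambda>_. 0)))"
      using measure_notin_sets[of E "S (?D (\<lambda>_. 0))"] by force
    then show ?thesis by (simp only: sets_S)
  qed
  define F where "F x = measure R {r. (r, \<lambda>i\<in>{..<q}. curve n (x i)) \<in> E}" for x
  have wsum_F: "measure (S (?D U)) E = wsum {..N} (site_weights N s U) q F"
    if "\<And>i. i < N \<Longrightarrow> 0 \<le> U i" "(\<Sum>i<N. U i) \<le> s" for U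
    unfolding S_def F_def
  proof (rule measure_finite_support_samples[OF _ _ _ _ site_dist_def R])
    show "0 \<le> site_weights N s U a" for a by (rule site_weights_nonneg[OF s0 that])
    show "E \<in> sets (R \<Otimes>\<^sub>M PiM {..<q} (\<lambda>_. ?D U))"
      using E unfolding sets_S[symmetric, of U] by (simp add: S_def)
  qed (use sum_site_weights[OF s0] curve_in_space in auto)
  show ?thesis
  proof (rule exI[of _ F], intro conjI allI impI; (elim conjE)?)
    show "0 \<le> F x" "F x \<le> 1" for x by (simp_all add: F_def)
  next
    fix U :: "nat \<Rightarrow> real"
    assume "\<forall>i<N. 0 \<le> U i" and U2: "(\<Sum>i<N. U i) \<le> s" and few: "card {i. i < N \<and> U i \<noteq> 0} \<le> k * (n div 2)"
    then have U1: "\<And>i. i < N \<Longrightarrow> 0 \<le> U i" by blast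
    from sparse[OF U1 U2 sparse_label_realised[OF nk(1) few]]
    show "2 / 3 \<le> wsum {..N} (site_weights N s U) q F"
      using wsum_F[OF U1 U2] by simp
  next
    fix U :: "nat \<Rightarrow> real"
    assume "\<forall>i<N. 0 \<le> U i" and U2: "(\<Sum>i<N. U i) \<le> s" and few: "card {i. i < N \<and> U i \<noteq> 1} \<le> n * k"
    then have U1: "\<And>i. i < N \<Longrightarrow> 0 \<le> U i" by blast
    have far: "2 / 3 \<le> measure (S (?D U)) {(r, xs) \<in> space (S (Rn n)). out r xs = False}"
      by (intro dense dense_class_dist[OF nk \<epsilon> N s] U1 U2 few)
    interpret D: prob_space "?D U"
      using distribution_on_site_dist[OF s0 U1 U2] by (simp add: distribution_on_def)
    interpret P: prob_space "PiM {..<q} (\<lambda>_. ?D U)"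
      by (intro prob_space_PiM D.prob_space_axioms)
    interpret RP: pair_prob_space R "PiM {..<q} (\<lambda>_. ?D U)" ..
    have "{(r, xs) \<in> space (S (Rn n)). out r xs = False} = space (S (?D U)) - E"
      unfolding space_S E_def by auto
    moreover have "E \<in> sets (S (?D U))" using E by (simp only: sets_S)
    then have "measure (S (?D U)) (space (S (?D U)) - E) = 1 - measure (S (?D U)) E"
      unfolding S_def by (rule RP.prob_compl)
    ultimately show "wsum {..N} (site_weights N s U) q F \<le> 1 / 3"
      using far wsum_F[OF U1 U2] by simp
  qed
qed

text \<open>Without samples the acceptance probability is one constant, yet \<open>U = 0\<close> is
  sparse and \<open>U = 1\<close> is dense. This settles small \<open>n * k\<close> and the case
  \<open>n = 1\<close>.\<close>

lemma separates_needs_samples: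
  assumes nk: "n \<ge> 1" "k \<ge> 1" and \<epsilon>: "\<epsilon> \<le> 1 / 480" and sep: "separates n k \<epsilon> q R out"
  shows "1 \<le> q"
proof (rule ccontr)
  assume "\<not> 1 \<le> q"
  then have q: "q = 0" by simp
  define N where "N = 2 * (4 * (n * k))"
  define s where "s = 120 * real N"
  obtain F :: "(nat \<Rightarrow> nat) \<Rightarrow> real" where
    F: "\<And>U. (\<forall>i<N. 0 \<le> U i) \<and> (\<Sum>i<N. U i) \<le> s \<Longrightarrow>
      (card {i. i < N \<and> U i \<noteq> 0} \<le> k * (n div 2) \<longrightarrow> 2 / 3 \<le> wsum {..N} (site_weights N s U) q F) \<and>
      (card {i. i < N \<and> U i \<noteq> 1} \<le> n * k \<longrightarrow> wsum {..N} (site_weights N s U) q F \<le> 1 / 3)"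
    using separates_acceptance[OF nk \<epsilon> sep N_def s_def] by blast
  show False using F[of "\<lambda>_. 0"] F[of "\<lambda>_. 1"] unfolding q wsum_0 by (simp add: s_def)
qed

lemma separates_moment_bound:
  assumes nk: "n \<ge> 2" "k \<ge> 1" and \<epsilon>: "\<epsilon> \<le> 1 / 480" and sep: "separates n k \<epsilon> q R out"
    and L: "1 \<le> L" "real (8 * (n * k)) * (2 * exp (- real L)) \<le> 1 / 20"
      "real (8 * (n * k)) * exp (1 - 108 * real (8 * (n * k)) / (9600 * (real L)\<^sup>2)) \<le> 1 / 20"
  shows "real L < exp 2 * (20 * (real L)\<^sup>2 / real (n * k)) * real q"
proof (rule ccontr)
  assume "\<not> ?thesis"
  then have few: "exp 2 * (20 * (real L)\<^sup>2 / real (n * k)) * real q \<le> real L" by simp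
  define N where "N = 2 * (4 * (n * k))"
  define s where "s = 120 * real N"
  have N8: "N = 8 * (n * k)" by (simp add: N_def)
  have n1: "1 \<le> n" using nk by simp
  obtain F :: "(nat \<Rightarrow> nat) \<Rightarrow> real" where F01: "\<And>x. 0 \<le> F x \<and> F x \<le> 1"
    and F: "\<And>U. (\<forall>i<N. 0 \<le> U i) \<and> (\<Sum>i<N. U i) \<le> s \<Longrightarrow>
      (card {i. i < N \<and> U i \<noteq> 0} \<le> k * (n div 2) \<longrightarrow> 2 / 3 \<le> wsum {..N} (site_weights N s U) q F) \<and>
      (card {i. i < N \<and> U i \<noteq> 1} \<le> n * k \<longrightarrow> wsum {..N} (site_weights N s U) q F \<le> 1 / 3)"
    using separates_acceptance[OF n1 nk(2) \<epsilon> sep N_def s_def] by blast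
  show False
  proof (rule sparse_dense_indistinguishable[OF F01 L(1) _ refl s_def])
    show "1 \<le> N" using nk by (simp add: N_def)
    show "real N * (2 * exp (- real L)) \<le> 1 / 20" using L(2) unfolding N8 .
    show "real N * exp (1 - 108 * real N / (9600 * (real L)\<^sup>2)) \<le> 1 / 20" using L(3) unfolding N8 .
    have "2 * (9600 * (real L)\<^sup>2) / s = 20 * (real L)\<^sup>2 / real (n * k)"
      using nk by (simp add: s_def N8 field_simps)
    then show "exp 2 * (2 * (9600 * (real L)\<^sup>2) / s) * real q \<le> real L" using few by simp
  next
    fix U assume U: "\<And>i. i < N \<Longrightarrow> 0 \<le> U i" "(\<Sum>i<N. U i) \<le> s"
      and "real (card {i. i < N \<and> U i \<noteq> 0}) \<le> real N / 24"
    then have "real (3 * card {i. i < N \<and> U i \<noteq> 0}) \<le> real (n * k)" by (simp add: N8 algebra_simps)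
    then have "3 * card {i. i < N \<and> U i \<noteq> 0} \<le> n * k" by (simp only: of_nat_le_iff)
    \<comment> \<open>\<open>n \<le> 3 * (n div 2)\<close> needs \<open>n \<ge> 2\<close> and is
      sharp at \<open>n = 3\<close>; it is the origin of the sparsity threshold
      \<open>N / 24\<close>, which is a third of \<open>n * k\<close>.\<close>
    also have "\<dots> \<le> (3 * (n div 2)) * k" using nk by (intro mult_right_mono) auto
    finally have "card {i. i < N \<and> U i \<noteq> 0} \<le> k * (n div 2)" by (simp add: mult.commute)
    then show "2 / 3 \<le> wsum {..N} (site_weights N s U) q F"
      using F[of U] U by blast
  next
    fix U assume U: "\<And>i. i < N \<Longrightarrow> 0 \<le> U i" "(\<Sum>i<N. U i) \<le> s"
      and "real (card {i. i < N \<and> U i \<noteq> 1}) \<le> real N / 8"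
    then have "real (card {i. i < N \<and> U i \<noteq> 1}) \<le> real (n * k)" by (simp add: N8)
    then have "card {i. i < N \<and> U i \<noteq> 1} \<le> n * k" by (simp only: of_nat_le_iff)
    then show "wsum {..N} (site_weights N s U) q F \<le> 1 / 3"
      using F[of U] U by blast
  qed
qed

lemma separates_lower_bound:
  "\<exists>c>0. \<forall>n k q \<epsilon> R out. n \<ge> 2 \<and> k \<ge> 1 \<and> \<epsilon> \<le> 1 / 480 \<and> separates n k \<epsilon> q R out \<longrightarrow>
    c * (real (n * k) / ln (real (n * k))) \<le> real q"
proof -
  obtain d0 where d0: "2 \<le> d0" and param: "\<And>d::nat. d \<ge> d0 \<Longrightarrow> \<exists>L::nat. 1 \<le> L \<and> real L \<le> 8 * ln (real d) \<and>
    real (8 * d) * (2 * exp (- real L)) \<le> 1 / 20 \<and>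
    real (8 * d) * exp (1 - 108 * real (8 * d) / (9600 * (real L)\<^sup>2)) \<le> 1 / 20"
    using parameters_exist by blast
  \<comment> \<open>160 is 20 from \<open>separates_moment_bound\<close> times 8 from the bound on
    \<open>L\<close>. The second term brings the bound down to at most 1 when
    \<open>d < d0\<close>.\<close>
  define c where "c = min (1 / (160 * exp 2)) (ln 2 / real d0)"
  show ?thesis
  proof (intro exI[of _ c] conjI allI impI)
    show "0 < c" using d0 by (simp add: c_def)
    fix n k q :: nat and \<epsilon> R out
    assume *: "n \<ge> 2 \<and> k \<ge> 1 \<and> \<epsilon> \<le> 1 / 480 \<and> separates n k \<epsilon> q R out"
    define d where "d = n * k"
    have d2: "2 \<le> d" unfolding d_def using * mult_le_mono[of 2 n 1 k] by simp
    then have ln_pos: "0 < ln (real d)" "ln 2 \<le> ln (real d)" by simp_all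
    have ratio: "0 \<le> real d / ln (real d)" using ln_pos by simp
    show "c * (real (n * k) / ln (real (n * k))) \<le> real q"
      unfolding d_def[symmetric]
    proof (cases "d0 \<le> d")
      case True
      then obtain L :: nat where L: "1 \<le> L" "real L \<le> 8 * ln (real d)"
        "real (8 * d) * (2 * exp (- real L)) \<le> 1 / 20"
        "real (8 * d) * exp (1 - 108 * real (8 * d) / (9600 * (real L)\<^sup>2)) \<le> 1 / 20"
        using param by blast
      have "real L < exp 2 * (20 * (real L)\<^sup>2 / real d) * real q"
        using separates_moment_bound[of n k \<epsilon> q R out L] * L unfolding d_def by blast
      also have "\<dots> = real L * (20 * exp 2 * real L * real q / real d)"
        by (simp add: power2_eq_square)
      finally have "real L * 1 < real L * (20 * exp 2 * real L * real q / real d)" by simp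
      then have "1 < 20 * exp 2 * real L * real q / real d"
        by (rule mult_left_less_imp_less) simp
      then have "real d < 20 * exp 2 * real L * real q" using d2 by (simp add: field_simps)
      also have "\<dots> \<le> 20 * exp 2 * (8 * ln (real d)) * real q"
        using L(2) by (intro mult_right_mono mult_left_mono) auto
      finally have "real d / ln (real d) \<le> 160 * exp 2 * real q"
        using ln_pos by (simp add: field_simps)
      then have "1 / (160 * exp 2) * (real d / ln (real d)) \<le> 1 / (160 * exp 2) * (160 * exp 2 * real q)"
        by (intro mult_left_mono) auto
      moreover have "c * (real d / ln (real d)) \<le> 1 / (160 * exp 2) * (real d / ln (real d))"
        using ratio by (intro mult_right_mono) (auto simp: c_def)
      ultimately show "c * (real d / ln (real d)) \<le> real q" by simp
    next
      case False
      have "c * (real d / ln (real d)) \<le> ln 2 / real d0 * (real d0 / ln 2)"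
        using False d0 d2 ln_pos ratio
        by (intro mult_mono frac_le) (auto simp: c_def)
      also have "\<dots> = 1" using d0 by simp
      also have "1 \<le> real q" using separates_needs_samples[of n k \<epsilon> q R out] * by simp
      finally show "c * (real d / ln (real d)) \<le> real q" .
    qed
  qed
qed

section \<open>Testers on the hard instances\<close>

lemma query_tester_separates:
  assumes nk: "n \<ge> 1" "k \<ge> 1" and test: "query_tester (Rn n) \<epsilon> (halfspace_intersections n k) q R A"
  shows "separates n k \<epsilon> q R (\<lambda>r. run (parity_label n (2 * (4 * (n * k)))) (A r))"
proof -
  define N where "N = 2 * (4 * (n * k))"
  define s where "s = 120 * real N"
  let ?f = "parity_label n N" and ?H = "halfspace_intersections n k"
  have s0: "0 < s" using nk by (simp add: s_def N_def)
  \<comment> \<open>The tester is run on the same labelling for all \<open>U\<close>, so its run is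
    a function of the seed and the sample points only. Acceptance at distance \<open>0\<close>
    covers the sparse instances.\<close>
  have "(class_dist (site_dist n N s U) ?f ?H = 0 \<longrightarrow> query_outcome_prob R (site_dist n N s U) ?f q A True \<ge> 2/3) \<and>
     (class_dist (site_dist n N s U) ?f ?H \<ge> \<epsilon> \<longrightarrow> query_outcome_prob R (site_dist n N s U) ?f q A False \<ge> 2/3)"
    if "\<forall>i<N. 0 \<le> U i" "(\<Sum>i<N. U i) \<le> s" for U
    using test distribution_on_site_dist[OF s0, of N U n] that parity_label_measurable[of n N]
    unfolding query_tester_def by blast
  moreover have "class_dist (site_dist n N s U) ?f ?H = 0"
    if "\<forall>i<N. 0 \<le> U i" "(\<Sum>i<N. U i) \<le> s"
      "\<exists>h\<in>?H. \<forall>t. site_weights N s U t \<noteq> 0 \<longrightarrow> h (curve n t) = ?f (curve n t)" for U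
    using sparse_class_dist[OF s0, of N U] that by blast
  moreover have "prob_space R" using test by (simp add: query_tester_def)
  ultimately show ?thesis
    unfolding separates_def Let_def N_def[symmetric] s_def[symmetric] query_outcome_prob_def by blast
qed

text \<open>
  A sample tester is only required to accept functions of the class itself, so on a sparse instance it
  is run on an \<open>h\<close> of the class that agrees with the labelling on the support.
\<close>

lemma sample_tester_separates:
  assumes nk: "n \<ge> 1" "k \<ge> 1" and \<epsilon>: "\<epsilon> \<le> 1 / 480"
    and test: "sample_tester (Rn n) \<epsilon> (halfspace_intersections n k) q R A"
  shows "separates n k \<epsilon> q R (\<lambda>r xs. A r (labelled_sample (parity_label n (2 * (4 * (n * k)))) q xs))"
proof -
  define N where "N = 2 * (4 * (n * k))"
  define s where "s = 120 * real N"
  let ?f = "parity_label n N" and ?H = "halfspace_intersections n k"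
  let ?D = "\<lambda>U. site_dist n N s U"
  define S where "S D = R \<Otimes>\<^sub>M PiM {..<q} (\<lambda>_. D)" for D :: "(nat \<Rightarrow> real) measure"
  define E where "E g = {(r, xs) \<in> space (S (Rn n)). A r (labelled_sample g q xs) = True}" for g
  have s0: "0 < s" using nk by (simp add: s_def N_def)
  have R: "prob_space R" using test by (simp add: sample_tester_def)
  have sets_S: "sets (S (?D U)) = sets (S (Rn n))" for U
    unfolding S_def by (intro sets_pair_measure_cong sets_PiM_cong refl sets_site_dist)
  have space_S: "space (S (?D U)) = space (S (Rn n))" for U
    by (rule sets_eq_imp_space_eq[OF sets_S])
  have dense: "2 / 3 \<le> measure (S (?D U)) {(r, xs) \<in> space (S (?D U)). A r (labelled_sample ?f q xs) = False}"
    if "\<forall>i<N. 0 \<le> U i" "(\<Sum>i<N. U i) \<le> s" "\<epsilon> \<le> class_dist (?D U) ?f ?H" for U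
    using test distribution_on_site_dist[OF s0, of N U n] that parity_label_measurable[of n N]
    unfolding sample_tester_def sample_outcome_prob_def S_def by blast
  \<comment> \<open>Acceptance on sparse instances is guaranteed for \<open>h\<close> only, so
    measurability of the event for the labelling itself comes from rejection on the dense instance
    \<open>U = 1\<close>.\<close>
  have E_f: "E ?f \<in> sets (S (Rn n))"
  proof -
    let ?G = "{(r, xs) \<in> space (S (Rn n)). A r (labelled_sample ?f q xs) = False}"
    have "2 / 3 \<le> measure (S (?D (\<lambda>_. 1))) ?G"
      unfolding space_S[of "\<lambda>_. 1", symmetric]
      by (intro dense dense_class_dist[OF nk \<epsilon> N_def s_def]) (auto simp: s_def)
    then have "?G \<in> sets (S (?D (\<lambda>_. 1)))"
      using measure_notin_sets[of ?G "S (?D (\<lambda>_. 1))"] by force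
    then have "space (S (Rn n)) - ?G \<in> sets (S (Rn n))" unfolding sets_S by blast
    moreover have "space (S (Rn n)) - ?G = E ?f" by (auto simp: E_def)
    ultimately show ?thesis by simp
  qed
  have sparse: "2 / 3 \<le> measure (S (?D U)) {(r, xs) \<in> space (S (?D U)). A r (labelled_sample ?f q xs) = True}"
    if U: "\<forall>i<N. 0 \<le> U i" "(\<Sum>i<N. U i) \<le> s" and h: "h \<in> ?H"
      and agree: "\<And>t. site_weights N s U t \<noteq> 0 \<Longrightarrow> h (curve n t) = ?f (curve n t)" for U h
  proof -
    have "in_class (Rn n) h ?H" using h by (auto simp: in_class_def)
    moreover have "distribution_on (Rn n) (?D U) \<and> h \<in> measurable (Rn n) (count_space UNIV)"
      using distribution_on_site_dist[OF s0, of N U n] U halfspace_intersection_measurable[OF h] by blast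
    ultimately have "2 / 3 \<le> sample_outcome_prob R (?D U) h q A True"
      using test unfolding sample_tester_def by blast
    then have h_acc: "2 / 3 \<le> measure (S (?D U)) (E h)"
      by (simp only: sample_outcome_prob_def S_def[symmetric] E_def space_S)
    then have E_h: "E h \<in> sets (S (?D U))"
      using measure_notin_sets[of "E h" "S (?D U)"] by force
    have wsum: "measure (S (?D U)) (E g)
        = wsum {..N} (site_weights N s U) q (\<lambda>x. measure R {r. (r, \<lambda>i\<in>{..<q}. curve n (x i)) \<in> E g})"
      if "E g \<in> sets (S (?D U))" for g
      unfolding S_def
    proof (rule measure_finite_support_samples[OF _ _ _ _ site_dist_def R])
      show "0 \<le> site_weights N s U a" for a by (rule site_weights_nonneg[OF s0]) (use U in auto)
      show "E g \<in> sets (R \<Otimes>\<^sub>M PiM {..<q} (\<lambda>_. ?D U))" using that by (simp add: S_def)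
    qed (use sum_site_weights[OF s0] curve_in_space in auto)
    have "measure (S (?D U)) (E h) = measure (S (?D U)) (E ?f)"
      unfolding wsum[OF E_h] wsum[OF E_f[unfolded sets_S[symmetric, of U]]]
    proof (rule wsum_cong)
      fix x assume "\<And>i. i < q \<Longrightarrow> site_weights N s U (x i) \<noteq> 0"
      then have "labelled_sample h q (\<lambda>i\<in>{..<q}. curve n (x i)) = labelled_sample ?f q (\<lambda>i\<in>{..<q}. curve n (x i))"
        using agree by (auto simp: labelled_sample_def)
      then show "measure R {r. (r, \<lambda>i\<in>{..<q}. curve n (x i)) \<in> E h} = measure R {r. (r, \<lambda>i\<in>{..<q}. curve n (x i)) \<in> E ?f}"
        by (simp only: E_def mem_Collect_eq case_prod_conv)
    qed
    then show ?thesis using h_acc unfolding space_S E_def by simp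
  qed
  show ?thesis
    unfolding separates_def Let_def N_def[symmetric] s_def[symmetric] S_def[symmetric]
    using R sparse dense by blast
qed

text \<open>A nonempty infimum in \<open>enat\<close> is attained; an empty one is infinite.\<close>

lemma ereal_le_Inf_enat:
  assumes "\<And>q. P q \<Longrightarrow> b \<le> real q"
  shows "ereal b \<le> ereal_of_enat (Inf {enat q | q. P q})"
proof (cases "\<exists>q. P q")
  case True
  then obtain q0 where "P q0" by (elim exE)
  then have "enat q0 \<in> {enat q | q. P q}" by blast
  from wellorder_InfI[OF this] obtain q where "P q" "Inf {enat q | q. P q} = enat q" by blast
  then show ?thesis using assms by simp
next
  case False
  then have "{enat q | q. P q} = {}" by blast
  then show ?thesis by (simp only: Inf_empty top_enat_def ereal_of_enat_simps) simp
qed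

theorem theorem3p9:
  "\<exists>\<epsilon>0::real. \<exists>c::real. \<exists>c1::nat \<Rightarrow> real.
     \<epsilon>0 > 0 \<and> c > 0 \<and> (\<forall>k. c1 k > 0) \<and>
     (\<forall>n k::nat. \<forall>\<epsilon>::real. n \<ge> 1 \<and> k \<ge> 1 \<and> 0 < \<epsilon> \<and> \<epsilon> \<le> \<epsilon>0 \<longrightarrow>
        (let C = (if n = 1 then c1 k else c);
             bound = C * (real (n * k) / ln (real (n * k)))
         in ereal bound \<le> ereal_of_enat (m_test (Rn n) \<epsilon> (halfspace_intersections n k)) \<and>
            ereal bound \<le> ereal_of_enat (q_test0 (Rn n) \<epsilon> (halfspace_intersections n k))))"
proof -
  obtain c where c: "c > 0" and bound: "\<And>n k q \<epsilon> R out. n \<ge> 2 \<Longrightarrow> k \<ge> 1 \<Longrightarrow> \<epsilon> \<le> 1 / 480 \<Longrightarrow>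
      separates n k \<epsilon> q R out \<Longrightarrow> c * (real (n * k) / ln (real (n * k))) \<le> real q"
    using separates_lower_bound by blast
  txt \<open>For \<open>n = 1\<close> the constant is such that the bound is at most \<open>1\<close>; at \<open>k = 1\<close> the bound is \<open>0\<close>, since \<open>1 / ln 1 = 1 / 0 = 0\<close>.\<close>
  define c1 where "c1 k = (if 2 \<le> k then ln (real k) / real k else 1)" for k :: nat
  have c1: "c1 k > 0" for k by (simp add: c1_def)
  have main: "(if n = 1 then c1 k else c) * (real (n * k) / ln (real (n * k))) \<le> real q"
    if nk: "n \<ge> 1" "k \<ge> 1" and \<epsilon>: "\<epsilon> \<le> 1 / 480" and sep: "separates n k \<epsilon> q R out" for n k q \<epsilon> R out
  proof (cases "n = 1")
    case True
    have "c1 k * (real k / ln (real k)) \<le> 1" using nk by (cases "k = 1") (auto simp: c1_def)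
    also have "1 \<le> real q" using separates_needs_samples[OF nk \<epsilon> sep] by simp
    finally show ?thesis using True by simp
  next
    case False
    then have "n \<ge> 2" using nk by simp
    from bound[OF this nk(2) \<epsilon> sep] False show ?thesis by simp
  qed
  show ?thesis
  \<comment> \<open>1/480 is the distance that \<open>dense_class_dist\<close> guarantees, whatever
    \<open>n\<close> and \<open>k\<close> are.\<close>
  proof (rule exI[of _ "1 / 480"], rule exI[of _ c], rule exI[of _ c1], intro conjI allI impI)
    fix n k :: nat and \<epsilon> :: real
    assume *: "n \<ge> 1 \<and> k \<ge> 1 \<and> 0 < \<epsilon> \<and> \<epsilon> \<le> 1 / 480"
    then have nk: "n \<ge> 1" "k \<ge> 1" and \<epsilon>: "\<epsilon> \<le> 1 / 480" by auto
    have "ereal ((if n = 1 then c1 k else c) * (real (n * k) / ln (real (n * k))))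
        \<le> ereal_of_enat (m_test (Rn n) \<epsilon> (halfspace_intersections n k))"
      unfolding m_test_def using main[OF nk \<epsilon> sample_tester_separates[OF nk \<epsilon>]]
      by (intro ereal_le_Inf_enat) blast
    moreover have "ereal ((if n = 1 then c1 k else c) * (real (n * k) / ln (real (n * k))))
        \<le> ereal_of_enat (q_test0 (Rn n) \<epsilon> (halfspace_intersections n k))"
      unfolding q_test0_def using main[OF nk \<epsilon> query_tester_separates[OF nk]]
      by (intro ereal_le_Inf_enat) blast
    ultimately show "let C = (if n = 1 then c1 k else c);
             bound = C * (real (n * k) / ln (real (n * k)))
         in ereal bound \<le> ereal_of_enat (m_test (Rn n) \<epsilon> (halfspace_intersections n k)) \<and>
            ereal bound \<le> ereal_of_enat (q_test0 (Rn n) \<epsilon> (halfspace_intersections n k))"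
      unfolding Let_def by (rule conjI)
  qed (use c c1 in simp_all)
qed

end
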